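(* Consider two qubits, i.e. the bipartite system $\mathbb{C}^2\otimes\mathbb{C}^2$, and let $S$ be the set of all density matrices on $\mathbb{C}^2\otimes\mathbb{C}^2$. For every Schmidt vector $\vec{\mu}=(\mu_1,\mu_2)$, every $p\in(0,1]$ and every $f\in[0,1]$, $$S_{\vec{\mu}}^{+}=S_{\vec{\mu}},\qquad (S^{\mathrm{prob}}_{\vec{\mu},p})^{+}=S^{\mathrm{prob}}_{\vec{\mu},p},\qquad (S^{\mathrm{app}}_{\vec{\mu},f})^{+}=S^{\mathrm{app}}_{\vec{\mu},f}.$$ Moreover, $$S^{\mathrm{prob}}_{(\mu_1,\mu_2),q}=S\qquad\text{whenever } 0<q\le 2\mu_2,$$ and $$S^{\mathrm{prob}}_{(\mu_1,\mu_2),q}=S_{(1-\mu_2/q,\ \mu_2/q)}\qquad\text{whenever } 2\mu_2<q\le 1.$$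
   Context: Setting: two parties, Alice and Bob, each hold one qubit, with Hilbert space $\mathbb{C}^2$. A Schmidt vector is $\vec{\mu}=(\mu_1,\mu_2)$ with $\mu_1\ge\mu_2\ge 0$ and $\mu_1+\mu_2=1$. For a bipartite pure state $|\psi\rangle$, $\vec{\lambda}_\psi=(\lambda^1_\psi,\lambda^2_\psi)$ denotes the vector of Schmidt coefficients in decreasing order, i.e. the eigenvalues, in decreasing order, of $\mathrm{Tr}_A|\psi\rangle\langle\psi|$. For vectors of length $n$ (here $n=2$) with entries in decreasing order and summing to 1: $\vec{\lambda}\succ\vec{\mu}$ means $\sum_{i=1}^k\lambda^i\ge\sum_{i=1}^k\mu^i$ for all $k=1,\dots,n$; and $p\vec{\lambda}\succ^w\vec{\mu}$ means $p\sum_{i=l}^n\lambda^i\le\sum_{i=l}^n\mu^i$ for all $l=1,\dots,n$. $\mathrm{LOCC}_1^A$ is the class of operations consisting of a local measurement/superoperator by Alice given by a set of commuting Kraus operators $A_i$ ($\sum_iA_i^\dagger A_i=\mathbf{1}$), followed by one-way classical communication from Alice to Bob, and local unitary transformations by Alice and Bob which may depend on Alice's outcome; i.e. maps $\mathcal{L}(\sigma)=\sum_i(U_iA_i\otimes V_i)\,\sigma\,(U_iA_i\otimes V_i)^\dagger$ with $U_i,V_i$ unitary. Sets of density matrices (for a pure state, membership of $|\psi\rangle$ means membership of $|\psi\rangle\langle\psi|$): - Exact: $S_{\vec{\mu}}$ is the convex closure of the set of pure states $|\psi\rangle$ with $\vec{\lambda}_\psi\succ\vec{\mu}$. - Probabilistic: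 $S^{\mathrm{prob}}_{\vec{\mu},p}$ is the convex closure of the set of pure states $|\psi\rangle$ with $p\vec{\lambda}_\psi\succ^w\vec{\mu}$. - Approximate: $S^{\mathrm{app}}_{\vec{\mu},f}$ is the convex closure of the set of pure states $|\psi\rangle$ for which there exists a pure state $|\xi\rangle\in S_{\vec{\mu}}$ with $|\langle\xi|\psi\rangle|\ge f$. For each such set $T$, $T^{+}=\{\mathcal{L}(|\psi\rangle\langle\psi|)\;|\;\mathcal{L}\in\mathrm{LOCC}_1^A,\ |\psi\rangle\in T\}$. *)

theory Defs
  imports
    "HOL-Analysis.Analysis"
    "HOL-Computational_Algebra.Polynomial"
begin

text \<open>
  Alice's tensor factor is the first component of the index type, Bob's the second, so that
  \<open>complex ^ (2 \<times> 2)\<close> is the two-qubit space.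
\<close>

type_synonym qubit_op = "complex ^ 2 ^ 2"
type_synonym ket2 = "complex ^ (2 \<times> 2)"
type_synonym op2 = "complex ^ (2 \<times> 2) ^ (2 \<times> 2)"

definition dagger :: "complex ^ 'n ^ 'm \<Rightarrow> complex ^ 'm ^ 'n" where
  "dagger A = (\<chi> i j. cnj (A $ j $ i))"

definition unitary :: "complex ^ 'n ^ 'n \<Rightarrow> bool" where
  "unitary U \<longleftrightarrow> dagger U ** U = mat 1 \<and> U ** dagger U = mat 1"

definition braket :: "complex ^ 'n \<Rightarrow> complex ^ 'n \<Rightarrow> complex" where
  "braket x y = (\<Sum>i\<in>UNIV. cnj (x $ i) * y $ i)"

definition ketbra :: "complex ^ 'n \<Rightarrow> complex ^ 'n ^ 'n" where
  "ketbra x = (\<chi> i j. x $ i * cnj (x $ j))"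

definition tensor_op ::
  "complex ^ 'a ^ 'a \<Rightarrow> complex ^ 'b ^ 'b \<Rightarrow> complex ^ ('a::finite \<times> 'b::finite) ^ ('a \<times> 'b)" where
  "tensor_op A B = (\<chi> i j. A $ fst i $ fst j * B $ snd i $ snd j)"

definition ptrace_A :: "complex ^ ('a::finite \<times> 'b::finite) ^ ('a \<times> 'b) \<Rightarrow> complex ^ 'b ^ 'b" where
  "ptrace_A R = (\<chi> i j. \<Sum>k\<in>UNIV. R $ (k, i) $ (k, j))"

definition char_polynomial :: "complex ^ 'n ^ 'n \<Rightarrow> complex poly" where
  "char_polynomial M = det (\<chi> i j. (if i = j then [:0, 1:] else 0) - [:M $ i $ j:])"

text \<open>
  Eigenvalues with algebraic multiplicity, in decreasing order. Taking real parts makes this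
  meaningful only for matrices with real spectrum; it is applied to Hermitian matrices.
\<close>

definition eigenvalues_desc :: "complex ^ 'n ^ 'n \<Rightarrow> real list" where
  "eigenvalues_desc M =
     rev (sorted_list_of_multiset (image_mset Re (proots (char_polynomial M))))"

definition pure_state :: "complex ^ 'n \<Rightarrow> bool" where
  "pure_state \<psi> \<longleftrightarrow> norm \<psi> = 1"

definition density_matrix :: "complex ^ 'n ^ 'n \<Rightarrow> bool" where
  "density_matrix R \<longleftrightarrow>
     dagger R = R \<and> (\<forall>v. 0 \<le> Re (braket v (R *v v))) \<and> trace R = 1"

definition schmidt_coeffs :: "ket2 \<Rightarrow> real list" where
  "schmidt_coeffs \<psi> = eigenvalues_desc (ptrace_A (ketbra \<psi>))"

definition majorizes :: "real list \<Rightarrow> real list \<Rightarrow> bool" where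
  "majorizes xs ys \<longleftrightarrow> length xs = length ys \<and>
     (\<forall>k\<in>{1..length xs}. sum_list (take k xs) \<ge> sum_list (take k ys))"

text \<open>
  \<open>scaled_weak_majorizes p xs ys\<close> is the relation \<open>p xs \<succ>\<^sup>w ys\<close>. The tail starting at the
  1-based position \<open>l + 1\<close> is \<open>drop l\<close>.
\<close>

definition scaled_weak_majorizes :: "real \<Rightarrow> real list \<Rightarrow> real list \<Rightarrow> bool" where
  "scaled_weak_majorizes p xs ys \<longleftrightarrow> length xs = length ys \<and>
     (\<forall>l<length xs. p * sum_list (drop l xs) \<le> sum_list (drop l ys))"

definition S_all :: "op2 set" where
  "S_all = {R. density_matrix R}"

text \<open>
  The generating sets of pure states below are compact, so in this finite-dimensional space
  their convex hulls are closed.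
\<close>

definition S_exact :: "real list \<Rightarrow> op2 set" where
  "S_exact \<mu> =
     convex hull {ketbra \<psi> | \<psi>. pure_state \<psi> \<and> majorizes (schmidt_coeffs \<psi>) \<mu>}"

definition S_prob :: "real list \<Rightarrow> real \<Rightarrow> op2 set" where
  "S_prob \<mu> p =
     convex hull {ketbra \<psi> | \<psi>. pure_state \<psi> \<and> scaled_weak_majorizes p (schmidt_coeffs \<psi>) \<mu>}"

definition S_app :: "real list \<Rightarrow> real \<Rightarrow> op2 set" where
  "S_app \<mu> f =
     convex hull {ketbra \<psi> | \<psi>. pure_state \<psi> \<and>
       (\<exists>\<xi>. pure_state \<xi> \<and> ketbra \<xi> \<in> S_exact \<mu> \<and> cmod (braket \<xi> \<psi>) \<ge> f)}"

text \<open>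
  Alice's measurement has finitely many outcomes \<open>i < n\<close>, and its Kraus operators commute
  pairwise; they need be neither normal nor Hermitian.
\<close>

definition LOCC1A :: "(op2 \<Rightarrow> op2) set" where
  "LOCC1A = {\<L>. \<exists>(n::nat) (A :: nat \<Rightarrow> qubit_op) (U :: nat \<Rightarrow> qubit_op) (V :: nat \<Rightarrow> qubit_op).
     (\<forall>i<n. \<forall>j<n. A i ** A j = A j ** A i) \<and>
     (\<Sum>i<n. dagger (A i) ** A i) = mat 1 \<and>
     (\<forall>i<n. unitary (U i) \<and> unitary (V i)) \<and>
     \<L> = (\<lambda>\<sigma>. \<Sum>i<n.
       tensor_op (U i ** A i) (V i) ** \<sigma> ** dagger (tensor_op (U i ** A i) (V i)))}"

definition locc_plus :: "op2 set \<Rightarrow> op2 set" where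
  "locc_plus T = {\<L> (ketbra \<psi>) | \<L> \<psi>. \<L> \<in> LOCC1A \<and> pure_state \<psi> \<and> ketbra \<psi> \<in> T}"

end

theory Submission
  imports Defs
begin

text \<open>
  All sets in question are convex hulls of sets of pure states described by an upper bound on the
  concurrence \<open>C(\<psi>) = 2 \<bar>det \<psi>\<bar>\<close>, the modulus of a quadratic form. If vectors \<open>w\<^sub>i\<close> satisfy
  \<open>\<Sum> \<bar>w\<^sub>i\<bar>\<^sup>2 = 1\<close>, then \<open>\<Sum> |w\<^sub>i><w\<^sub>i|\<close> is a mixture of pure states of concurrence at most
  \<open>\<Sum> C(w\<^sub>i)\<close>: for two vectors, expand both in isotropic vectors of the form on their span, where the
  form is the modulus of the off-diagonal coefficient, and move along the diagonal to the boundary of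
  the positive cone; then iterate. Kraus operators of Alice scale the concurrence by \<open>\<bar>det A\<^sub>i\<bar>\<close>, and
  \<open>\<Sum> \<bar>det A\<^sub>i\<bar> \<le> tr (\<Sum> A\<^sub>i\<^sup>\<dagger> A\<^sub>i) / 2 = 1\<close>, so LOCC does not leave the hull. Conversely, a mixture of
  finitely many generators is reached from a diagonal state with the largest occurring concurrence by
  Nielsen's protocol, whose Kraus operators are diagonal and therefore commute.
\<close>

section \<open>Sums of rank-one operators and a quadratic form\<close>

text \<open>For two qubits one number orders all pure states: the smaller Schmidt coefficient is an
  increasing function of the concurrence, so each generating set is a down-set for the concurrence.
  For the approximate family this is itself something to prove. The obstacle to closure is that a
  single measurement outcome may be more entangled than the input; only the sum of the unnormalized
  concurrences is controlled. A different ensemble of the same operator is therefore required, all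
  of whose members respect the bound. Merging two vectors at a time needs only that the form is
  bilinear and symmetric, and it avoids a simultaneous normal form of the operator and the form.
  Norms are tracked exactly, so that the final members are unit vectors. A second point is that
  \<open>locc_plus\<close> ranges over pure states in a convex hull rather than over generators;
  extremality of pure states leads back to generators.\<close>

lemma mult_cnj_self: "z * cnj z = (of_real (cmod z))\<^sup>2"
  using complex_norm_square[of z] by simp

lemma cnj_mult_self: "cnj z * z = (of_real (cmod z))\<^sup>2"
  using mult_cnj_self[of z] by (simp add: mult.commute)

lemma norm_power2_vec: "(norm (x :: complex ^ 'n))\<^sup>2 = (\<Sum>i\<in>UNIV. (cmod (x $ i))\<^sup>2)"
  by (simp add: norm_vec_def L2_set_def sum_nonneg)

lemma braket_self: "braket x x = of_real ((norm x)\<^sup>2)"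
  by (simp add: braket_def norm_power2_vec mult_cnj_self cnj_mult_self)

lemma braket_add_right: "braket x (y + z) = braket x y + braket x z"
  by (simp add: braket_def algebra_simps sum.distrib)

lemma braket_add_left: "braket (x + y) z = braket x z + braket y z"
  by (simp add: braket_def algebra_simps sum.distrib)

lemma braket_diff_right: "braket x (y - z) = braket x y - braket x z"
  by (simp add: braket_def algebra_simps sum_subtractf)

lemma braket_smult_right: "braket x (c *s y) = c * braket x y"
  by (simp add: braket_def sum_distrib_left algebra_simps)

lemma braket_smult_left: "braket (c *s x) y = cnj c * braket x y"
  by (simp add: braket_def sum_distrib_left algebra_simps)

lemma cnj_braket: "cnj (braket x y) = braket y x"
  by (simp add: braket_def mult.commute)

lemma norm_smult_complex: "norm (c *s (x :: complex ^ 'n)) = cmod c * norm x"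
proof -
  have "(norm (c *s x))\<^sup>2 = (cmod c * norm x)\<^sup>2"
    by (simp add: norm_power2_vec power_mult_distrib norm_mult sum_distrib_left)
  then show ?thesis by (simp add: power2_eq_iff_nonneg)
qed

lemma norm_power2_comb:
  fixes e f :: "complex ^ 'n"
  shows "(norm (x *s e + y *s f))\<^sup>2
    = (cmod x)\<^sup>2 * (norm e)\<^sup>2 + (cmod y)\<^sup>2 * (norm f)\<^sup>2 + 2 * Re (x * cnj y * braket f e)"
proof -
  have "complex_of_real ((norm (x *s e + y *s f))\<^sup>2) = braket (x *s e + y *s f) (x *s e + y *s f)"
    by (simp add: braket_self)
  also have "\<dots> = cnj x * x * braket e e + cnj y * y * braket f f
      + (x * cnj y * braket f e + cnj (x * cnj y * braket f e))"
    by (simp add: braket_add_left braket_add_right braket_smult_left braket_smult_right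
        cnj_braket algebra_simps)
  also have "\<dots> = of_real ((cmod x)\<^sup>2 * (norm e)\<^sup>2 + (cmod y)\<^sup>2 * (norm f)\<^sup>2
      + 2 * Re (x * cnj y * braket f e))"
    unfolding complex_add_cnj braket_self
    by (simp add: mult_cnj_self cnj_mult_self)
  finally show ?thesis using of_real_eq_iff by blast
qed

lemma ketbra_comb:
  "ketbra (x *s e + y *s f) $ i $ j = x * cnj x * (e $ i * cnj (e $ j)) + y * cnj y * (f $ i * cnj (f $ j))
     + x * cnj y * (e $ i * cnj (f $ j)) + cnj (x * cnj y) * (f $ i * cnj (e $ j))"
  by (simp add: ketbra_def algebra_simps)

text \<open>On the span of \<open>e\<close> and \<open>f\<close> a ketbra is linear in its 2x2
  coefficient matrix with entries |x|^2, |y|^2 and x cnj y, so matching these entries is enough. The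
  vectors are arbitrary; isotropic ones need not be orthogonal.\<close>

lemma ketbra_add_eq_convex_comb:
  fixes e f :: "complex ^ 'n"
  assumes "(cmod x1)\<^sup>2 + (cmod x2)\<^sup>2 = t * (cmod a1)\<^sup>2 + (1 - t) * (cmod a2)\<^sup>2"
    and "(cmod y1)\<^sup>2 + (cmod y2)\<^sup>2 = t * (cmod b1)\<^sup>2 + (1 - t) * (cmod b2)\<^sup>2"
    and "x1 * cnj y1 + x2 * cnj y2 = of_real t * (a1 * cnj b1) + of_real (1 - t) * (a2 * cnj b2)"
  shows "ketbra (x1 *s e + y1 *s f) + ketbra (x2 *s e + y2 *s f)
    = t *\<^sub>R ketbra (a1 *s e + b1 *s f) + (1 - t) *\<^sub>R ketbra (a2 *s e + b2 *s f)"
proof -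
  have n: "z * cnj z = of_real ((cmod z)\<^sup>2)" for z by (simp add: mult_cnj_self)
  have 1: "x1 * cnj x1 + x2 * cnj x2 = of_real t * (a1 * cnj a1) + of_real (1 - t) * (a2 * cnj a2)"
    unfolding n using arg_cong[OF assms(1), of complex_of_real] by simp
  have 2: "y1 * cnj y1 + y2 * cnj y2 = of_real t * (b1 * cnj b1) + of_real (1 - t) * (b2 * cnj b2)"
    unfolding n using arg_cong[OF assms(2), of complex_of_real] by simp
  have 4: "cnj (x1 * cnj y1) + cnj (x2 * cnj y2)
      = of_real t * cnj (a1 * cnj b1) + of_real (1 - t) * cnj (a2 * cnj b2)"
    using arg_cong[OF assms(3), of cnj] by simp
  show ?thesis
    unfolding vec_eq_iff
  proof (intro allI)
    fix i j
    define E F P Q where "E = e $ i * cnj (e $ j)" and "F = f $ i * cnj (f $ j)"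
      and "P = e $ i * cnj (f $ j)" and "Q = f $ i * cnj (e $ j)"
    have "(x1 * cnj x1 + x2 * cnj x2) * E + (y1 * cnj y1 + y2 * cnj y2) * F
        + (x1 * cnj y1 + x2 * cnj y2) * P + (cnj (x1 * cnj y1) + cnj (x2 * cnj y2)) * Q
      = (of_real t * (a1 * cnj a1) + of_real (1 - t) * (a2 * cnj a2)) * E
        + (of_real t * (b1 * cnj b1) + of_real (1 - t) * (b2 * cnj b2)) * F
        + (of_real t * (a1 * cnj b1) + of_real (1 - t) * (a2 * cnj b2)) * P
        + (of_real t * cnj (a1 * cnj b1) + of_real (1 - t) * cnj (a2 * cnj b2)) * Q"
      by (simp only: 1 2 4 assms(3))
    then show "(ketbra (x1 *s e + y1 *s f) + ketbra (x2 *s e + y2 *s f)) $ i $ j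
      = (t *\<^sub>R ketbra (a1 *s e + b1 *s f) + (1 - t) *\<^sub>R ketbra (a2 *s e + b2 *s f)) $ i $ j"
      unfolding vector_add_component vector_scaleR_component ketbra_comb scaleR_conv_of_real[where 'a = complex]
        E_def[symmetric] F_def[symmetric] P_def[symmetric] Q_def[symmetric]
      by (simp only: algebra_simps)
  qed
qed

text \<open>Cauchy-Schwarz: the coefficient matrix of a sum of two ketbras has nonnegative
  determinant.\<close>

lemma cmod_offdiag_power2_le:
  "(cmod (x1 * cnj y1 + x2 * cnj y2))\<^sup>2
    \<le> ((cmod x1)\<^sup>2 + (cmod x2)\<^sup>2) * ((cmod y1)\<^sup>2 + (cmod y2)\<^sup>2)"
proof -
  have "cmod (x1 * cnj y1 + x2 * cnj y2) \<le> cmod x1 * cmod y1 + cmod x2 * cmod y2"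
    using norm_triangle_ineq[of "x1 * cnj y1" "x2 * cnj y2"] by (simp add: norm_mult)
  then have "(cmod (x1 * cnj y1 + x2 * cnj y2))\<^sup>2 \<le> (cmod x1 * cmod y1 + cmod x2 * cmod y2)\<^sup>2"
    by (simp add: power_mono)
  also have "\<dots> \<le> ((cmod x1)\<^sup>2 + (cmod x2)\<^sup>2) * ((cmod y1)\<^sup>2 + (cmod y2)\<^sup>2)"
    using zero_le_power2[of "cmod x1 * cmod y2 - cmod x2 * cmod y1"]
    by (simp add: power2_eq_square algebra_simps)
  finally show ?thesis .
qed

text \<open>A point of a disc is the midpoint of the chord through it perpendicular to its radius.
  It serves the degenerate form, where an off-diagonal coefficient is averaged between two of
  maximal modulus.\<close>

lemma midpoint_on_circle:
  assumes "cmod z \<le> r"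
  obtains y1 y2 where "cmod y1 = r" "cmod y2 = r" "y1 + y2 = 2 * z"
proof (cases "z = 0")
  case True
  have "r \<ge> 0" using assms norm_ge_zero[of z] by linarith
  then show ?thesis using that[of "of_real r" "- of_real r"] True by simp
next
  case False
  define u where "u = sgn z"
  define h where "h = sqrt (r\<^sup>2 - (cmod z)\<^sup>2)"
  have u: "cmod u = 1" "z = u * of_real (cmod z)"
    using False by (simp_all add: u_def norm_sgn sgn_eq norm_divide)
  have r: "r \<ge> 0" using assms norm_ge_zero[of z] by linarith
  have h: "(cmod z)\<^sup>2 + h\<^sup>2 = r\<^sup>2"
    using assms by (simp add: h_def power_mono)
  have 1: "cmod (u * Complex (cmod z) h) = r" "cmod (u * Complex (cmod z) (-h)) = r"
    using u(1) h r by (auto simp: norm_mult complex_norm)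
  have "u * Complex (cmod z) h + u * Complex (cmod z) (-h) = 2 * (u * of_real (cmod z))"
    by (simp add: complex_eq_iff)
  then show ?thesis by (intro that[OF 1]) (simp only: u(2)[symmetric])
qed

section \<open>Merging two vectors under a symmetric bilinear form\<close>

locale symmetric_form =
  fixes B :: "complex ^ 'n \<Rightarrow> complex ^ 'n \<Rightarrow> complex"
  assumes add_left: "B (x + y) z = B x z + B y z"
    and smult_left: "B (c *s x) y = c * B x y"
    and sym: "B x y = B y x"
begin

lemma add_right: "B z (x + y) = B z x + B z y"
  by (metis add_left sym)

lemma smult_right: "B y (c *s x) = c * B y x"
  by (metis smult_left sym)

lemma comb: "B (x *s e + y *s f) (x *s e + y *s f) = x\<^sup>2 * B e e + y\<^sup>2 * B f f + 2 * x * y * B e f"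
  by (simp add: add_left add_right smult_left smult_right sym[of f e] power2_eq_square algebra_simps)

text \<open>The vectors are not normalized: the squared norm is prescribed exactly and acts as the
  trace of \<open>ketbra u\<close>, while the form is only bounded, which makes the sets monotone in
  \<open>T\<close>.\<close>

definition level :: "real \<Rightarrow> real \<Rightarrow> (complex ^ 'n) set" where
  "level N T = {u. (norm u)\<^sup>2 = N \<and> cmod (B u u) \<le> T}"

text \<open>
  On the span of two isotropic vectors \<open>|B u u|\<close> is the modulus of the off-diagonal coefficient of
  \<open>ketbra u\<close>, up to a constant factor. So one may move along the diagonal until the coefficient
  matrix has rank one.
\<close>

lemma isotropic_unit_pair_hull:
  fixes e f :: "complex ^ 'n"
  assumes e: "norm e = 1" "B e e = 0" and f: "norm f = 1" "B f f = 0"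
    and v: "v = x1 *s e + y1 *s f" and w: "w = x2 *s e + y2 *s f"
  shows "ketbra v + ketbra w
    \<in> convex hull (ketbra ` level ((norm v)\<^sup>2 + (norm w)\<^sup>2) (cmod (B v v) + cmod (B w w)))"
proof -
  define \<alpha> where "\<alpha> = (cmod x1)\<^sup>2 + (cmod x2)\<^sup>2"
  define \<beta> where "\<beta> = (cmod y1)\<^sup>2 + (cmod y2)\<^sup>2"
  define r where "r = x1 * cnj y1 + x2 * cnj y2"
  define \<omega> where "\<omega> = (if r = 0 then 1 else sgn r)"
  have \<omega>: "cmod \<omega> = 1" "of_real (cmod r) * \<omega> = r"
    by (simp_all add: \<omega>_def sgn_eq norm_divide)
  define m where "m = \<alpha> + \<beta>"
  \<comment> \<open>Rank one with trace m and off-diagonal modulus |r| forces the diagonal entries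
    to be the roots (m + D)/2 and (m - D)/2 of X^2 - m X + |r|^2; they become p^2 and q^2.\<close>
  define D where "D = sqrt (m\<^sup>2 - 4 * (cmod r)\<^sup>2)"
  have pos: "\<alpha> \<ge> 0" "\<beta> \<ge> 0" by (auto simp: \<alpha>_def \<beta>_def)
  have r: "(cmod r)\<^sup>2 \<le> \<alpha> * \<beta>" unfolding r_def \<alpha>_def \<beta>_def by (rule cmod_offdiag_power2_le)
  have D1: "m\<^sup>2 - 4 * (cmod r)\<^sup>2 \<ge> (\<alpha> - \<beta>)\<^sup>2"
    using r by (simp add: m_def power2_eq_square algebra_simps)
  then have D2: "m\<^sup>2 - 4 * (cmod r)\<^sup>2 \<ge> 0" using zero_le_power2[of "\<alpha> - \<beta>"] by linarith
  have D: "D \<ge> 0" "D\<^sup>2 = m\<^sup>2 - 4 * (cmod r)\<^sup>2" using D2 by (auto simp: D_def)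
  have m: "m \<ge> 0" using pos by (simp add: m_def)
  have "D\<^sup>2 \<le> m\<^sup>2" unfolding D(2) by simp
  then have Dm: "D \<le> m" using m by (rule power2_le_imp_le)
  have "\<bar>\<alpha> - \<beta>\<bar>\<^sup>2 \<le> D\<^sup>2" unfolding D(2) using D1 by simp
  then have D\<alpha>: "\<bar>\<alpha> - \<beta>\<bar> \<le> D" using D(1) by (rule power2_le_imp_le)
  define p where "p = sqrt ((m + D) / 2)"
  define q where "q = sqrt ((m - D) / 2)"
  have p: "p \<ge> 0" "p\<^sup>2 = (m + D) / 2" and q: "q \<ge> 0" "q\<^sup>2 = (m - D) / 2"
    using D Dm by (auto simp: p_def q_def)
  have "(p * q)\<^sup>2 = (m\<^sup>2 - D\<^sup>2) / 4"
    unfolding power_mult_distrib p(2) q(2) by (simp add: power2_eq_square algebra_simps)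
  also have "\<dots> = (cmod r)\<^sup>2" unfolding D(2) by simp
  finally have "(p * q)\<^sup>2 = (cmod r)\<^sup>2" .
  then have pq: "p * q = cmod r" using p q by (simp add: power2_eq_iff_nonneg)
  \<comment> \<open>Position of the given diagonal between (p^2, q^2) and (q^2, p^2), which enclose
    it because |\<alpha> - \<beta>| \<le> D. If D = 0 the two coincide and any weight works.\<close>
  define t where "t = (if D = 0 then 0 else (\<alpha> - q\<^sup>2) / D)"
  have t: "0 \<le> t" "t \<le> 1" using D\<alpha> D q by (auto simp: t_def m_def field_simps)
  have t\<alpha>: "\<alpha> = t * p\<^sup>2 + (1 - t) * q\<^sup>2"
  proof (cases "D = 0")
    case True
    then show ?thesis using D\<alpha> p q by (simp add: t_def m_def)
  next
    case False
    have "p\<^sup>2 = q\<^sup>2 + D" using p q by (simp add: field_simps)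
    then show ?thesis using False by (simp add: t_def field_simps)
  qed
  have t\<beta>: "\<beta> = t * q\<^sup>2 + (1 - t) * p\<^sup>2"
  proof -
    have "p\<^sup>2 + q\<^sup>2 = \<alpha> + \<beta>" using p q by (simp add: m_def)
    then show ?thesis using t\<alpha> by (simp add: algebra_simps)
  qed
  define u1 where "u1 = of_real p *s e + (of_real q * cnj \<omega>) *s f"
  define u2 where "u2 = of_real q *s e + (of_real p * cnj \<omega>) *s f"
  have kb: "ketbra v + ketbra w = t *\<^sub>R ketbra u1 + (1 - t) *\<^sub>R ketbra u2"
    unfolding v w u1_def u2_def
  proof (rule ketbra_add_eq_convex_comb)
    have "of_real p * of_real q * \<omega> = r" unfolding of_real_mult[symmetric] pq by (rule \<omega>(2))
    then show "x1 * cnj y1 + x2 * cnj y2 = of_real t * (of_real p * cnj (of_real q * cnj \<omega>))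
        + of_real (1 - t) * (of_real q * cnj (of_real p * cnj \<omega>))"
      by (simp add: r_def[symmetric] algebra_simps)
    show "(cmod x1)\<^sup>2 + (cmod x2)\<^sup>2
        = t * (cmod (of_real p))\<^sup>2 + (1 - t) * (cmod (of_real q))\<^sup>2"
      unfolding \<alpha>_def[symmetric] using t\<alpha> by simp
    show "(cmod y1)\<^sup>2 + (cmod y2)\<^sup>2
        = t * (cmod (of_real q * cnj \<omega>))\<^sup>2 + (1 - t) * (cmod (of_real p * cnj \<omega>))\<^sup>2"
      unfolding \<beta>_def[symmetric] using t\<beta> \<omega>(1) by (simp add: norm_mult)
  qed
  \<comment> \<open>For unit \<open>e\<close> and \<open>f\<close> the squared norm depends only on
    the trace and the off-diagonal entry of the coefficient matrix, so it is constant along the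
    diagonal move even if \<open>e\<close> and \<open>f\<close> are not orthogonal.\<close>
  have N0: "(norm v)\<^sup>2 + (norm w)\<^sup>2 = m + 2 * Re (r * braket f e)"
    by (simp add: v w norm_power2_comb e f m_def \<alpha>_def \<beta>_def r_def algebra_simps)
  have pqr: "of_real p * of_real q * \<omega> = r" unfolding of_real_mult[symmetric] pq by (rule \<omega>(2))
  have N1: "(norm u1)\<^sup>2 = m + 2 * Re (r * braket f e)"
    unfolding u1_def norm_power2_comb e f pqr[symmetric]
    by (simp add: norm_mult power_mult_distrib \<omega>(1) p q field_simps)
  have N2: "(norm u2)\<^sup>2 = m + 2 * Re (r * braket f e)"
    unfolding u2_def norm_power2_comb e f pqr[symmetric]
    by (simp add: norm_mult power_mult_distrib \<omega>(1) p q field_simps)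
  have B1: "cmod (B u1 u1) = 2 * cmod r * cmod (B e f)" 
    unfolding u1_def comb e f pq[symmetric] using p q by (simp add: norm_mult \<omega>(1))
  have B2: "cmod (B u2 u2) = 2 * cmod r * cmod (B e f)" 
    unfolding u2_def comb e f pq[symmetric] using p q by (simp add: norm_mult \<omega>(1))
  have "cmod r \<le> cmod x1 * cmod y1 + cmod x2 * cmod y2"
    using norm_triangle_ineq[of "x1 * cnj y1" "x2 * cnj y2"] by (simp add: norm_mult r_def)
  then have "cmod r * cmod (B e f) \<le> (cmod x1 * cmod y1 + cmod x2 * cmod y2) * cmod (B e f)"
    by (simp add: mult_right_mono)
  then have B0: "2 * cmod r * cmod (B e f) \<le> cmod (B v v) + cmod (B w w)"
    unfolding v w comb e f by (simp add: norm_mult algebra_simps)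
  have "u1 \<in> level ((norm v)\<^sup>2 + (norm w)\<^sup>2) (cmod (B v v) + cmod (B w w))"
    "u2 \<in> level ((norm v)\<^sup>2 + (norm w)\<^sup>2) (cmod (B v v) + cmod (B w w))"
    using N0 N1 N2 B0 B1 B2 by (auto simp: level_def)
  then show ?thesis unfolding kb using t
    by (intro convexD[OF convex_convex_hull hull_inc hull_inc] imageI) simp_all
qed

text \<open>Here \<open>f\<close> lies in the radical of the form on the span, so |B u u| sees only
  the \<open>e\<close>-coefficient, and by orthogonality the norm sees only the diagonal. The
  diagonal can be kept while the \<open>f\<close>-coefficient moves on the circle of radius sqrt
  \<beta>; the required off-diagonal entry is the average of two choices there.\<close>

lemma kernel_pair_hull:
  fixes e f :: "complex ^ 'n"
  assumes ef: "braket f e = 0" and f: "norm f = 1" "B f f = 0" "B e f = 0"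
    and v: "v = x1 *s e + y1 *s f" and w: "w = x2 *s e + y2 *s f"
  shows "ketbra v + ketbra w
    \<in> convex hull (ketbra ` level ((norm v)\<^sup>2 + (norm w)\<^sup>2) (cmod (B v v) + cmod (B w w)))"
proof -
  define \<alpha> where "\<alpha> = (cmod x1)\<^sup>2 + (cmod x2)\<^sup>2"
  define \<beta> where "\<beta> = (cmod y1)\<^sup>2 + (cmod y2)\<^sup>2"
  define r where "r = x1 * cnj y1 + x2 * cnj y2"
  have pos: "\<alpha> \<ge> 0" "\<beta> \<ge> 0" by (auto simp: \<alpha>_def \<beta>_def)
  have r: "(cmod r)\<^sup>2 \<le> \<alpha> * \<beta>" unfolding r_def \<alpha>_def \<beta>_def by (rule cmod_offdiag_power2_le)
  \<comment> \<open>The \<open>f\<close>-coefficient that goes with the \<open>e\<close>-coefficient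
    sqrt \<alpha>. For \<alpha> = 0 also r = 0, and the quotient by zero gives the correct value
    0.\<close>
  define z where "z = cnj r / of_real (sqrt \<alpha>)"
  have rz: "r = of_real (sqrt \<alpha>) * cnj z"
    using r pos by (cases "\<alpha> = 0") (auto simp: z_def)
  have "(cmod z)\<^sup>2 \<le> \<beta>"
    using r pos by (cases "\<alpha> = 0") (auto simp: z_def norm_divide power_divide field_simps)
  then have "cmod z \<le> sqrt \<beta>" by (rule real_le_rsqrt)
  then obtain b1 b2 where b: "cmod b1 = sqrt \<beta>" "cmod b2 = sqrt \<beta>" "b1 + b2 = 2 * z"
    by (rule midpoint_on_circle)
  define u where "u b = of_real (sqrt \<alpha>) *s e + b *s f" for b
  have kb: "ketbra v + ketbra w = (1/2) *\<^sub>R ketbra (u b1) + (1 - 1/2) *\<^sub>R ketbra (u b2)"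
    unfolding v w u_def
  proof (rule ketbra_add_eq_convex_comb)
    have "of_real (1/2) * (of_real (sqrt \<alpha>) * cnj b1) + of_real (1 - 1/2) * (of_real (sqrt \<alpha>) * cnj b2)
      = of_real (sqrt \<alpha>) * cnj (b1 + b2) / 2" by (simp add: algebra_simps add_divide_distrib)
    also have "\<dots> = r" using b(3) rz by simp
    finally show "x1 * cnj y1 + x2 * cnj y2 = of_real (1/2) * (of_real (sqrt \<alpha>) * cnj b1)
        + of_real (1 - 1/2) * (of_real (sqrt \<alpha>) * cnj b2)" by (simp add: r_def)
  qed (use b pos in \<open>simp_all add: \<alpha>_def \<beta>_def\<close>)
  have "u b \<in> level ((norm v)\<^sup>2 + (norm w)\<^sup>2) (cmod (B v v) + cmod (B w w))"
    if "cmod b = sqrt \<beta>" for b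
  proof -
    have "(norm (u b))\<^sup>2 = (norm v)\<^sup>2 + (norm w)\<^sup>2"
      unfolding u_def v w norm_power2_comb ef f
      using that pos by (simp add: \<alpha>_def \<beta>_def algebra_simps)
    moreover have "cmod (B (u b) (u b)) = cmod (B v v) + cmod (B w w)"
    proof -
      have "cmod (B (u b) (u b)) = \<alpha> * cmod (B e e)"
        using pos unfolding u_def comb f by (simp add: norm_mult norm_power del: of_real_power)
      then show ?thesis
        unfolding v w comb f by (simp add: norm_mult norm_power \<alpha>_def algebra_simps)
    qed
    ultimately show ?thesis by (simp add: level_def)
  qed
  then show ?thesis unfolding kb using b
    by (intro convexD[OF convex_convex_hull hull_inc hull_inc] imageI) simp_all
qed

end

lemma ketbra_zero [simp]: "ketbra 0 = 0"
  by (simp add: ketbra_def vec_eq_iff)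

lemma ketbra_smult: "ketbra (c *s x) = (cmod c)\<^sup>2 *\<^sub>R ketbra x"
proof -
  have "c * a * cnj (c * b) = (cmod c)\<^sup>2 *\<^sub>R (a * cnj b)" for a b
    unfolding scaleR_conv_of_real complex_norm_square by simp
  then show ?thesis by (simp add: ketbra_def vec_eq_iff)
qed

lemma smult_normalize:
  fixes e :: "complex ^ 'n"
  assumes "e \<noteq> 0"
  obtains f where "norm f = 1" "e = of_real (norm e) *s f" "f = of_real (inverse (norm e)) *s e"
proof
  show "norm (of_real (inverse (norm e)) *s e) = 1" using assms by (simp add: norm_smult_complex norm_inverse)
  show "e = of_real (norm e) *s (of_real (inverse (norm e)) *s e)"
    using assms by (simp add: vector_smult_assoc flip: of_real_mult)
qed simp

context symmetric_form
begin

lemma level_self: "u \<in> level ((norm u)\<^sup>2) (cmod (B u u))"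
  by (simp add: level_def)

lemma zero_left: "B 0 x = 0"
  using smult_left[of 0 0 x] by simp

lemma isotropic_pair_hull:
  fixes e f :: "complex ^ 'n"
  assumes e: "e \<noteq> 0" "B e e = 0" and f: "f \<noteq> 0" "B f f = 0"
    and v: "v = x1 *s e + y1 *s f" and w: "w = x2 *s e + y2 *s f"
  shows "ketbra v + ketbra w
    \<in> convex hull (ketbra ` level ((norm v)\<^sup>2 + (norm w)\<^sup>2) (cmod (B v v) + cmod (B w w)))"
proof -
  obtain e' where e': "norm e' = 1" "e = of_real (norm e) *s e'" "e' = of_real (inverse (norm e)) *s e"
    using e(1) by (rule smult_normalize)
  obtain f' where f': "norm f' = 1" "f = of_real (norm f) *s f'" "f' = of_real (inverse (norm f)) *s f"
    using f(1) by (rule smult_normalize)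
  have B: "B e' e' = 0" "B f' f' = 0"
    unfolding e'(3) f'(3) smult_left smult_right using e f by auto
  show ?thesis
  proof (rule isotropic_unit_pair_hull[OF e'(1) B(1) f'(1) B(2)])
    show "v = (x1 * of_real (norm e)) *s e' + (y1 * of_real (norm f)) *s f'"
      unfolding v vector_smult_assoc[symmetric] e'(2)[symmetric] f'(2)[symmetric] ..
    show "w = (x2 * of_real (norm e)) *s e' + (y2 * of_real (norm f)) *s f'"
      unfolding w vector_smult_assoc[symmetric] e'(2)[symmetric] f'(2)[symmetric] ..
  qed
qed

text \<open>As \<open>B v v\<close> is nonzero, the form is a true quadratic along z v + w. Two
  distinct roots give two isotropic vectors with the same span; a double root gives an isotropic
  vector that is B-orthogonal to \<open>v\<close>, hence in the radical on the span.\<close>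

lemma nonisotropic_pair_hull:
  assumes a: "B v v \<noteq> 0"
  shows "ketbra v + ketbra w
    \<in> convex hull (ketbra ` level ((norm v)\<^sup>2 + (norm w)\<^sup>2) (cmod (B v v) + cmod (B w w)))"
proof -
  define a b d where "a = B v v" and "b = B v w" and "d = B w w"
  define \<delta> where "\<delta> = csqrt (b\<^sup>2 - a * d)"
  have \<delta>: "\<delta>\<^sup>2 = b\<^sup>2 - a * d" by (simp add: \<delta>_def)
  have a0: "a \<noteq> 0" using a by (simp add: a_def)
  have quad: "B (z *s v + w) (z *s v + w) = z\<^sup>2 * a + d + 2 * z * b" for z
    using comb[of z v 1 w] by (simp add: a_def b_def d_def)
  show ?thesis
  proof (cases "\<delta> = 0")
    case False
    define z1 z2 where "z1 = (\<delta> - b) / a" and "z2 = (- \<delta> - b) / a"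
    define e f where "e = z1 *s v + w" and "f = z2 *s v + w"
    have z: "a * z1 = \<delta> - b" "a * z2 = - \<delta> - b" using a0 by (simp_all add: z1_def z2_def)
    have "a * B e e = (a * z1)\<^sup>2 + a * d + 2 * (a * z1) * b"
      unfolding e_def quad by (simp add: power2_eq_square algebra_simps)
    also have "\<dots> = \<delta>\<^sup>2 - (b\<^sup>2 - a * d)" unfolding z by (simp add: power2_eq_square algebra_simps)
    finally have e: "B e e = 0" using \<delta> a0 by simp
    have "a * B f f = (a * z2)\<^sup>2 + a * d + 2 * (a * z2) * b"
      unfolding f_def quad by (simp add: power2_eq_square algebra_simps)
    also have "\<dots> = \<delta>\<^sup>2 - (b\<^sup>2 - a * d)" unfolding z by (simp add: power2_eq_square algebra_simps)
    finally have f: "B f f = 0" using \<delta> a0 by simp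
    have nz: "z *s v + w \<noteq> 0" for z
    proof
      assume "z *s v + w = 0"
      then have w: "w = (- z) *s v" by (simp add: vec_eq_iff eq_neg_iff_add_eq_0 add.commute)
      have "b = - z * a" "d = z\<^sup>2 * a"
        unfolding a_def b_def d_def w smult_left smult_right by (simp_all add: power2_eq_square)
      then have "\<delta>\<^sup>2 = 0" unfolding \<delta> by (simp add: power2_eq_square)
      then show False using False by simp
    qed
    \<comment> \<open>e - f = (z1 - z2) v with z1 - z2 = 2\<delta>/a, so \<open>k\<close> is the
      factor that recovers \<open>v\<close>.\<close>
    define k where "k = a / (2 * \<delta>)"
    have k: "k * (z1 - z2) = 1" using False a0 by (simp add: k_def z1_def z2_def field_simps)
    have "k *s e + (- k) *s f = (k * (z1 - z2)) *s v"
      by (simp add: e_def f_def vec_eq_iff algebra_simps)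
    then have v: "v = k *s e + (- k) *s f" using k by simp
    have "w = 1 *s e + (- z1) *s v" by (simp add: e_def vec_eq_iff)
    also have "\<dots> = (1 - z1 * k) *s e + (z1 * k) *s f"
      by (subst v) (simp add: vec_eq_iff algebra_simps)
    finally show ?thesis
      using isotropic_pair_hull[OF _ e _ f v] nz unfolding e_def f_def by blast
  next
    case True
    \<comment> \<open>The double root is -c, and \<open>e\<close> is the point of the line z v + w
      belonging to it.\<close>
    define c where "c = b / a"
    define e where "e = w - c *s v"
    have w: "w = c *s v + e" by (simp add: e_def)
    have e': "e = (- c) *s v + w" by (simp add: e_def vec_eq_iff)
    have "a * B e e = a * d - b\<^sup>2"
      unfolding e' quad using a0 by (simp add: c_def power2_eq_square field_simps)
    then have e: "B e e = 0" using \<delta> a0 True by simp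
    have ve: "B v e = 0"
      unfolding e' add_right smult_right using a0 by (simp add: c_def a_def b_def)
    show ?thesis
    proof (cases "e = 0")
      case True
      define s where "s = sqrt (1 + (cmod c)\<^sup>2)"
      have s: "s\<^sup>2 = 1 + (cmod c)\<^sup>2" by (simp add: s_def)
      have w: "w = c *s v" using w True by simp
      have "ketbra v + ketbra w = s\<^sup>2 *\<^sub>R ketbra v"
        unfolding w ketbra_smult s by (simp add: algebra_simps)
      then have "ketbra v + ketbra w = ketbra (of_real s *s v)" by (simp add: ketbra_smult)
      moreover have "of_real s *s v \<in> level ((norm v)\<^sup>2 + (norm w)\<^sup>2) (cmod (B v v) + cmod (B w w))"
      proof -
        have 1: "(norm (of_real s *s v))\<^sup>2 = s\<^sup>2 * (norm v)\<^sup>2"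
          by (simp add: norm_smult_complex power_mult_distrib)
        have 2: "cmod (B (of_real s *s v) (of_real s *s v)) = s\<^sup>2 * cmod (B v v)"
          unfolding smult_left smult_right by (simp add: norm_mult power2_eq_square)
        have 3: "cmod (B w w) = (cmod c)\<^sup>2 * cmod (B v v)"
          unfolding w smult_left smult_right by (simp add: norm_mult power2_eq_square)
        have 4: "(norm w)\<^sup>2 = (cmod c)\<^sup>2 * (norm v)\<^sup>2"
          unfolding w by (simp add: norm_smult_complex power_mult_distrib)
        show ?thesis unfolding level_def mem_Collect_eq 1 2 3 4 s by (simp add: algebra_simps)
      qed
      ultimately show ?thesis by (simp add: hull_inc)
    next
      case False
      then obtain f where f: "norm f = 1" "e = of_real (norm e) *s f"
          "f = of_real (inverse (norm e)) *s e"
        by (rule smult_normalize)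
      \<comment> \<open>Gram-Schmidt against \<open>f\<close>: since \<open>f\<close> lies in the
        radical, replacing \<open>v\<close> by \<open>g\<close> leaves the form unchanged and
        supplies the orthogonality that the kernel case asks for.\<close>
      define \<kappa> where "\<kappa> = braket f v"
      define g where "g = v - \<kappa> *s f"
      have v': "v = 1 *s g + \<kappa> *s f" by (simp add: g_def)
      have g': "g = v + (- \<kappa>) *s f" by (simp add: g_def vec_eq_iff)
      have "braket f g = 0"
        by (simp add: g_def braket_diff_right braket_smult_right braket_self f(1) \<kappa>_def)
      moreover have Bff: "B f f = 0" unfolding f(3) smult_left smult_right e by simp
      moreover have "B v f = 0" unfolding f(3) smult_right ve by simp
      then have "B g f = 0" unfolding g' add_left smult_left Bff by simp
      moreover have "w = c *s g + (c * \<kappa> + of_real (norm e)) *s f"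
      proof -
        have "w = c *s (1 *s g + \<kappa> *s f) + of_real (norm e) *s f"
          unfolding v'[symmetric] f(2)[symmetric] by (rule w)
        then show ?thesis by (simp add: vec_eq_iff algebra_simps)
      qed
      ultimately show ?thesis using kernel_pair_hull[OF _ f(1) _ _ v'] by blast
    qed
  qed
qed

lemma pair_hull:
  "ketbra v + ketbra w
    \<in> convex hull (ketbra ` level ((norm v)\<^sup>2 + (norm w)\<^sup>2) (cmod (B v v) + cmod (B w w)))"
proof -
  consider "v = 0" | "w = 0" | "B v v \<noteq> 0" | "B w w \<noteq> 0"
    | "v \<noteq> 0" "w \<noteq> 0" "B v v = 0" "B w w = 0" by blast
  then show ?thesis
  proof cases
    case 1
    then show ?thesis using level_self[of w] by (simp add: hull_inc zero_left)
  next
    case 2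
    then show ?thesis using level_self[of v] by (simp add: hull_inc zero_left)
  next
    case 3
    then show ?thesis by (rule nonisotropic_pair_hull)
  next
    case 4
    then show ?thesis using nonisotropic_pair_hull[of w v] by (simp add: add.commute)
  next
    case 5
    have "v = 1 *s v + 0 *s w" "w = 0 *s v + 1 *s w" by simp_all
    then show ?thesis using isotropic_pair_hull[OF 5(1,3) 5(2,4)] by blast
  qed
qed

text \<open>The operators whose translate by \<open>ketbra w\<close> lies in the target hull form a
  convex set, so only generators \<open>ketbra u\<close> have to be checked, and there the
  two-vector case applies.\<close>

lemma hull_level_add_ketbra:
  assumes "X \<in> convex hull (ketbra ` level N T)"
  shows "X + ketbra w \<in> convex hull (ketbra ` level (N + (norm w)\<^sup>2) (T + cmod (B w w)))"
proof -
  let ?C = "convex hull (ketbra ` level (N + (norm w)\<^sup>2) (T + cmod (B w w)))"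
  have "convex ((\<lambda>X. - ketbra w + X) ` ?C)"
    by (intro convex_translation convex_convex_hull)
  also have "(\<lambda>X. - ketbra w + X) ` ?C = {X. X + ketbra w \<in> ?C}"
    by (force simp: image_iff algebra_simps)
  finally have "convex {X. X + ketbra w \<in> ?C}" .
  moreover have "ketbra ` level N T \<subseteq> {X. X + ketbra w \<in> ?C}"
  proof safe
    fix u assume u: "u \<in> level N T"
    then have "level ((norm u)\<^sup>2 + (norm w)\<^sup>2) (cmod (B u u) + cmod (B w w))
        \<subseteq> level (N + (norm w)\<^sup>2) (T + cmod (B w w))"
      by (auto simp: level_def)
    then show "ketbra u + ketbra w \<in> ?C"
      by (rule subsetD[OF hull_mono[OF image_mono] pair_hull])
  qed
  ultimately have "convex hull (ketbra ` level N T) \<subseteq> {X. X + ketbra w \<in> ?C}"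
    by (intro hull_minimal)
  then show ?thesis using assms by blast
qed

lemma sum_ketbra_in_hull_level:
  "(\<Sum>i<n::nat. ketbra (w i))
    \<in> convex hull (ketbra ` level (\<Sum>i<n. (norm (w i))\<^sup>2) (\<Sum>i<n. cmod (B (w i) (w i))))"
proof (induction n)
  case 0
  have "0 \<in> level 0 0" by (simp add: level_def zero_left)
  then have "ketbra 0 \<in> convex hull (ketbra ` level 0 0)" by (intro hull_inc imageI)
  then show ?case by simp
next
  case (Suc n)
  then show ?case using hull_level_add_ketbra by simp
qed

end

section \<open>Concurrence and local operations\<close>

lemma sum_2x2: "(\<Sum>i\<in>(UNIV :: (2 \<times> 2) set). f i) = f (1, 1) + f (1, 2) + f (2, 1) + f (2, 2)"
  by (simp add: UNIV_Times_UNIV[symmetric] sum.cartesian_product' sum_2 add.assoc del: UNIV_Times_UNIV)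

lemma dagger_dagger [simp]: "dagger (dagger A) = A"
  by (simp add: dagger_def vec_eq_iff)

lemma dagger_mult: "dagger (A ** B) = dagger B ** dagger A"
  by (simp add: dagger_def matrix_matrix_mult_def vec_eq_iff mult.commute)

lemma dagger_mat_1 [simp]: "dagger (mat 1) = mat 1"
  by (simp add: dagger_def mat_def vec_eq_iff)

lemma braket_dagger: "braket x (A *v y) = braket (dagger A *v x) y"
  unfolding braket_def dagger_def matrix_vector_mult_def
  by (simp add: sum_distrib_left sum_distrib_right mult.assoc mult.left_commute) (rule sum.swap)

lemma ketbra_image: "ketbra (A *v x) = A ** ketbra x ** dagger A"
  by (simp add: ketbra_def dagger_def matrix_vector_mult_def matrix_matrix_mult_def vec_eq_iff
      sum_distrib_left sum_distrib_right algebra_simps)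

lemma unitaryI: "dagger U ** U = mat 1 \<Longrightarrow> unitary U" for U :: "complex ^ 'n ^ 'n"
  by (simp add: unitary_def matrix_left_right_inverse)

lemma unitary_mat_1 [simp]: "unitary (mat 1)"
  by (simp add: unitary_def)

lemma unitary_mult: "unitary U \<Longrightarrow> unitary V \<Longrightarrow> unitary (U ** V)"
  unfolding unitary_def dagger_mult
  by (metis matrix_mul_assoc matrix_mul_rid)

lemma unitary_dagger: "unitary U \<Longrightarrow> unitary (dagger U)"
  by (simp add: unitary_def)

lemma braket_unitary: "unitary U \<Longrightarrow> braket (U *v x) (U *v y) = braket x y"
  by (simp add: braket_dagger matrix_vector_mul_assoc unitary_def)

lemma norm_unitary: "unitary U \<Longrightarrow> norm (U *v x) = norm x"
  using braket_unitary[of U x x] unfolding braket_self of_real_eq_iff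
  by (simp add: power2_eq_iff_nonneg)

lemma tensor_op_mult: "tensor_op A B ** tensor_op C D = tensor_op (A ** C) (B ** D)"
  by (simp add: tensor_op_def matrix_matrix_mult_def vec_eq_iff UNIV_Times_UNIV[symmetric]
      sum_product sum.cartesian_product case_prod_unfold algebra_simps del: UNIV_Times_UNIV)

lemma dagger_tensor_op: "dagger (tensor_op A B) = tensor_op (dagger A) (dagger B)"
  by (simp add: tensor_op_def dagger_def vec_eq_iff)

lemma tensor_op_mat_1: "tensor_op (mat 1) (mat 1) = mat 1"
  by (simp add: tensor_op_def mat_def vec_eq_iff)

lemma unitary_tensor_op: "unitary U \<Longrightarrow> unitary V \<Longrightarrow> unitary (tensor_op U V)"
  by (simp add: unitary_def dagger_tensor_op tensor_op_mult tensor_op_mat_1)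

lemma tensor_op_sum_left: "tensor_op (\<Sum>i\<in>I. A i) B = (\<Sum>i\<in>I. tensor_op (A i) B)"
  by (simp add: tensor_op_def vec_eq_iff sum_distrib_right)

text \<open>The polarization of twice the determinant of the 2x2 coefficient matrix; the factor two
  lets \<open>concurrence\<close> run up to 1 on unit vectors.\<close>

definition cform :: "ket2 \<Rightarrow> ket2 \<Rightarrow> complex" where
  "cform x y = x $ (1, 1) * y $ (2, 2) + y $ (1, 1) * x $ (2, 2)
     - x $ (1, 2) * y $ (2, 1) - y $ (1, 2) * x $ (2, 1)"

definition concurrence :: "ket2 \<Rightarrow> real" where
  "concurrence \<psi> = cmod (cform \<psi> \<psi>)"

interpretation cform: symmetric_form cform
  by unfold_locales (simp_all add: cform_def algebra_simps)

text \<open>On coefficient matrices the local operator acts as M -> A M B^T, so the determinant is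
  multiplied by det A det B.\<close>

lemma cform_tensor_op:
  "cform (tensor_op A B *v x) (tensor_op A B *v x) = det A * det B * cform x x"
  unfolding cform_def det_2 tensor_op_def matrix_vector_mult_def
  by (simp add: sum_2x2) algebra

lemma det_dagger: "det (dagger A) = cnj (det A)" for A :: qubit_op
  by (simp add: det_2 dagger_def mult.commute)

lemma cmod_det_unitary: "unitary U \<Longrightarrow> cmod (det U) = 1" for U :: qubit_op
proof -
  assume "unitary U"
  then have "det (dagger U ** U) = 1" by (simp add: unitary_def)
  then have "(of_real (cmod (det U)))\<^sup>2 = (1 :: complex)" by (simp add: det_mul det_dagger cnj_mult_self)
  then have "(cmod (det U))\<^sup>2 = 1" by (metis of_real_eq_1_iff of_real_power)
  then show ?thesis by (simp add: power2_eq_1_iff) (metis norm_ge_zero not_one_le_zero neg_0_le_iff_le)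
qed

lemma concurrence_local_unitary:
  "unitary U \<Longrightarrow> unitary V \<Longrightarrow> concurrence (tensor_op U V *v \<psi>) = concurrence \<psi>"
  by (simp add: concurrence_def cform_tensor_op norm_mult cmod_det_unitary)

lemma concurrence_smult: "concurrence (c *s \<psi>) = (cmod c)\<^sup>2 * concurrence \<psi>"
  by (simp add: concurrence_def cform.smult_left cform.smult_right norm_mult power2_eq_square)

lemma norm_power2_2x2:
  "(norm (\<psi> :: ket2))\<^sup>2 = (cmod (\<psi> $ (1,1)))\<^sup>2 + (cmod (\<psi> $ (1,2)))\<^sup>2 + (cmod (\<psi> $ (2,1)))\<^sup>2 + (cmod (\<psi> $ (2,2)))\<^sup>2"
  by (simp add: norm_power2_vec sum_2x2)

lemma two_mult_le_sum_squares: "2 * (a * b) \<le> a\<^sup>2 + (b :: real)\<^sup>2"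
  using zero_le_power2[of "a - b"] by (simp add: power2_eq_square algebra_simps)

lemma concurrence_le: "concurrence \<psi> \<le> (norm \<psi>)\<^sup>2"
proof -
  let ?p = "\<lambda>i j. cmod (\<psi> $ (i, j))"
  have "cform \<psi> \<psi> = 2 * (\<psi> $ (1,1) * \<psi> $ (2,2)) - 2 * (\<psi> $ (1,2) * \<psi> $ (2,1))"
    by (simp add: cform_def)
  then have "concurrence \<psi> \<le> 2 * (?p 1 1 * ?p 2 2) + 2 * (?p 1 2 * ?p 2 1)"
    unfolding concurrence_def
    using norm_triangle_ineq4[of "2 * (\<psi> $ (1,1) * \<psi> $ (2,2))" "2 * (\<psi> $ (1,2) * \<psi> $ (2,1))"]
    by (simp add: norm_mult)
  then show ?thesis
    using two_mult_le_sum_squares[of "?p 1 1" "?p 2 2"] two_mult_le_sum_squares[of "?p 1 2" "?p 2 1"]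
    by (simp add: norm_power2_2x2)
qed

lemma trace_dagger_mult: "trace (dagger A ** A) = of_real (\<Sum>j\<in>UNIV. \<Sum>i\<in>UNIV. (cmod (A $ i $ j))\<^sup>2)"
  by (simp add: trace_def matrix_matrix_mult_def dagger_def cnj_mult_self)

lemma cmod_det_le: "2 * cmod (det A) \<le> Re (trace (dagger A ** A))" for A :: qubit_op
proof -
  let ?p = "\<lambda>i j. cmod (A $ i $ j)"
  have "cmod (det A) \<le> ?p 1 1 * ?p 2 2 + ?p 1 2 * ?p 2 1"
    unfolding det_2 by (rule order_trans[OF norm_triangle_ineq4]) (simp add: norm_mult)
  then show ?thesis
    using two_mult_le_sum_squares[of "?p 1 1" "?p 2 2"] two_mult_le_sum_squares[of "?p 1 2" "?p 2 1"]
    unfolding trace_dagger_mult by (simp add: sum_2)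
qed

lemma trace_sum: "trace (\<Sum>i\<in>I. A i) = (\<Sum>i\<in>I. trace (A i))" for A :: "'i \<Rightarrow> complex ^ 'n ^ 'n"
  unfolding trace_def by (simp add: sum.swap[of _ UNIV I])

lemma matrix_vector_mult_sum_left:
  "(\<Sum>i\<in>I. A i) *v x = (\<Sum>i\<in>I. A i *v (x :: complex ^ 'n))" for A :: "'i \<Rightarrow> complex ^ 'n ^ 'm"
  by (induction I rule: infinite_finite_induct) (simp_all add: matrix_vector_mult_add_rdistrib)

lemma braket_sum_right: "braket x (\<Sum>i\<in>I. y i) = (\<Sum>i\<in>I. braket x (y i))"
  by (induction I rule: infinite_finite_induct) (simp_all add: braket_add_right, simp_all add: braket_def)

lemma sum_norm_image_power2:
  fixes K :: "'i \<Rightarrow> complex ^ 'n ^ 'n"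
  assumes "(\<Sum>i\<in>I. dagger (K i) ** K i) = mat 1"
  shows "(\<Sum>i\<in>I. (norm (K i *v x))\<^sup>2) = (norm x)\<^sup>2"
proof -
  have "of_real (\<Sum>i\<in>I. (norm (K i *v x))\<^sup>2) = (\<Sum>i\<in>I. braket x ((dagger (K i) ** K i) *v x))"
    by (simp add: braket_self[symmetric] braket_dagger matrix_vector_mul_assoc[symmetric] del: of_real_power)
  also have "\<dots> = braket x ((\<Sum>i\<in>I. dagger (K i) ** K i) *v x)"
    by (simp add: matrix_vector_mult_sum_left braket_sum_right)
  also have "\<dots> = of_real ((norm x)\<^sup>2)" using assms by (simp add: braket_self)
  finally show ?thesis using of_real_eq_iff by blast
qed

lemma LOCC1A_ketbra_in_hull:
  assumes L: "\<L> \<in> LOCC1A" and \<psi>: "pure_state \<psi>"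
  shows "\<L> (ketbra \<psi>) \<in> convex hull (ketbra ` {\<phi>. pure_state \<phi> \<and> concurrence \<phi> \<le> concurrence \<psi>})"
proof -
  from L obtain n :: nat and A U V :: "nat \<Rightarrow> qubit_op"
    where A: "(\<Sum>i<n. dagger (A i) ** A i) = mat 1"
      and UV: "\<And>i. i < n \<Longrightarrow> unitary (U i) \<and> unitary (V i)"
      and L: "\<L> = (\<lambda>\<sigma>. \<Sum>i<n.
       tensor_op (U i ** A i) (V i) ** \<sigma> ** dagger (tensor_op (U i ** A i) (V i)))"
    unfolding LOCC1A_def by blast
  define K where "K i = tensor_op (U i ** A i) (V i)" for i
  have out: "\<L> (ketbra \<psi>) = (\<Sum>i<n. ketbra (K i *v \<psi>))"
    unfolding L ketbra_image K_def ..
  \<comment> \<open>The local unitaries cancel, which leaves Alice's completeness relation tensored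
    with the identity.\<close>
  have "(\<Sum>i<n. dagger (K i) ** K i) = (\<Sum>i<n. tensor_op (dagger (A i) ** A i) (mat 1))"
  proof (intro sum.cong refl)
    fix i assume "i \<in> {..<n}"
    then have "dagger (U i) ** U i = mat 1" "dagger (V i) ** V i = mat 1"
      using UV by (auto simp: unitary_def)
    then show "dagger (K i) ** K i = tensor_op (dagger (A i) ** A i) (mat 1)"
      unfolding K_def dagger_tensor_op tensor_op_mult dagger_mult
      by (metis matrix_mul_assoc matrix_mul_lid)
  qed
  also have "\<dots> = mat 1" by (simp add: tensor_op_sum_left[symmetric] A tensor_op_mat_1)
  finally have N: "(\<Sum>i<n. (norm (K i *v \<psi>))\<^sup>2) = 1"
    using sum_norm_image_power2[of K "{..<n}" \<psi>] \<psi> by (simp add: pure_state_def)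
  have "(\<Sum>i<n. cmod (det (A i))) \<le> (\<Sum>i<n. Re (trace (dagger (A i) ** A i)) / 2)"
    using cmod_det_le by (intro sum_mono) (simp add: field_simps)
  also have "\<dots> = Re (trace (\<Sum>i<n. dagger (A i) ** A i)) / 2"
    by (simp add: trace_sum sum_divide_distrib)
  also have "\<dots> = 1" unfolding A by (simp add: trace_def mat_def)
  finally have D: "(\<Sum>i<n. cmod (det (A i))) \<le> 1" .
  have "(\<Sum>i<n. cmod (cform (K i *v \<psi>) (K i *v \<psi>))) = (\<Sum>i<n. cmod (det (A i))) * concurrence \<psi>"
    unfolding K_def cform_tensor_op concurrence_def sum_distrib_right
    by (intro sum.cong refl) (simp add: det_mul norm_mult cmod_det_unitary UV)
  also have "\<dots> \<le> concurrence \<psi>"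
    using D by (simp add: mult_left_le_one_le concurrence_def sum_nonneg)
  finally have T: "(\<Sum>i<n. cmod (cform (K i *v \<psi>) (K i *v \<psi>))) \<le> concurrence \<psi>" .
  have "\<L> (ketbra \<psi>) \<in> convex hull (ketbra ` cform.level 1 (\<Sum>i<n. cmod (cform (K i *v \<psi>) (K i *v \<psi>))))"
    unfolding out using cform.sum_ketbra_in_hull_level[of "\<lambda>i. K i *v \<psi>" n] unfolding N .
  also have "\<dots> \<subseteq> convex hull (ketbra ` {\<phi>. pure_state \<phi> \<and> concurrence \<phi> \<le> concurrence \<psi>})"
    using T by (intro hull_mono image_mono)
      (auto simp: cform.level_def pure_state_def concurrence_def abs_square_eq_1)
  finally show ?thesis .
qed

section \<open>Extremality of pure states\<close>

lemma braket_ketbra: "braket x (ketbra y *v x) = of_real ((cmod (braket x y))\<^sup>2)"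
proof -
  have "ketbra y *v x = braket y x *s y"
    by (simp add: ketbra_def braket_def matrix_vector_mult_def vec_eq_iff sum_distrib_left mult_ac)
  then have "braket x (ketbra y *v x) = braket x y * cnj (braket x y)"
    by (simp add: braket_smult_right cnj_braket mult.commute)
  then show ?thesis by (simp add: mult_cnj_self)
qed

lemma Re_braket_comb:
  fixes X Y :: "complex ^ 'n ^ 'n"
  shows "Re (braket v ((a *\<^sub>R X + b *\<^sub>R Y) *v v)) = a * Re (braket v (X *v v)) + b * Re (braket v (Y *v v))"
proof -
  have "a *\<^sub>R X *v v = of_real a *s (X *v v)" for a and X :: "complex ^ 'n ^ 'n"
    by (simp add: matrix_vector_mult_def vec_eq_iff scaleR_conv_of_real[where 'a = complex] sum_distrib_left mult.assoc)
  then show ?thesis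
    by (simp add: matrix_vector_mult_add_rdistrib braket_add_right braket_smult_right)
qed

text \<open>Equality case of Cauchy-Schwarz: the squared distance of \<phi> from its projection onto
  \<psi> is 1 - |\<open>braket \<psi> \<phi>\<close>|^2. Assuming only \<ge> lets the lemma also
  yield the upper bound 1 on overlaps.\<close>

lemma eq_smult_of_braket:
  assumes "norm \<psi> = 1" "norm \<phi> = 1" "cmod (braket \<psi> \<phi>) \<ge> 1"
  shows "\<phi> = braket \<psi> \<phi> *s \<psi>" "cmod (braket \<psi> \<phi>) = 1"
proof -
  have "(norm (1 *s \<phi> + (- braket \<psi> \<phi>) *s \<psi>))\<^sup>2 = 1 + (cmod (braket \<psi> \<phi>))\<^sup>2
      - 2 * Re (braket \<psi> \<phi> * cnj (braket \<psi> \<phi>))"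
    unfolding norm_power2_comb by (simp add: assms mult.commute)
  also have "\<dots> = 1 - (cmod (braket \<psi> \<phi>))\<^sup>2"
    unfolding mult_cnj_self by (simp flip: of_real_power)
  finally have *: "(norm (1 *s \<phi> + (- braket \<psi> \<phi>) *s \<psi>))\<^sup>2 = 1 - (cmod (braket \<psi> \<phi>))\<^sup>2" .
  moreover have "(cmod (braket \<psi> \<phi>))\<^sup>2 \<ge> 1" using assms(3) by (simp add: one_le_power)
  ultimately have 0: "(norm (1 *s \<phi> + (- braket \<psi> \<phi>) *s \<psi>))\<^sup>2 = 0"
    using zero_le_power2[of "norm (1 *s \<phi> + (- braket \<psi> \<phi>) *s \<psi>)"] by linarith
  then show "\<phi> = braket \<psi> \<phi> *s \<psi>" by (simp add: vec_eq_iff)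
  show "cmod (braket \<psi> \<phi>) = 1" using * 0 by (simp add: abs_square_eq_1)
qed

text \<open>
  Otherwise all generators, hence the hull, lie in the open half space of operators whose expectation
  in \<open>\<psi>\<close> is less than \<open>1\<close>.
\<close>

lemma pure_in_hull:
  assumes \<psi>: "pure_state \<psi>" and hull: "ketbra \<psi> \<in> convex hull (ketbra ` G)"
    and G: "\<And>\<phi>. \<phi> \<in> G \<Longrightarrow> pure_state \<phi>"
  obtains \<phi> c where "\<phi> \<in> G" "\<phi> = c *s \<psi>" "cmod c = 1"
proof -
  let ?F = "{X. Re (braket \<psi> (X *v \<psi>)) < 1}"
  have "convex ?F"
  proof (rule convexI)
    fix X Y and a b :: real assume *: "X \<in> ?F" "Y \<in> ?F" "0 \<le> a" "0 \<le> b" "a + b = 1"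
    let ?x = "Re (braket \<psi> (X *v \<psi>))" and ?y = "Re (braket \<psi> (Y *v \<psi>))"
    have "a * ?x + b * ?y < 1"
      using * convex_bound_lt[of ?x 1 ?y a b] by simp
    then show "a *\<^sub>R X + b *\<^sub>R Y \<in> ?F" by (simp add: Re_braket_comb)
  qed
  moreover have "ketbra \<psi> \<notin> ?F"
    using \<psi> by (simp add: braket_ketbra braket_self pure_state_def)
  ultimately have "\<not> ketbra ` G \<subseteq> ?F" using hull hull_minimal[of "ketbra ` G" ?F convex] by blast
  then obtain \<phi> where \<phi>: "\<phi> \<in> G" "ketbra \<phi> \<notin> ?F" by blast
  from \<phi>(2) have "(cmod (braket \<psi> \<phi>))\<^sup>2 \<ge> 1" by (simp add: braket_ketbra not_less)
  then have "cmod (braket \<psi> \<phi>) \<ge> 1" by (metis abs_norm_cancel abs_square_less_1 linorder_not_less)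
  then show thesis
    using that[OF \<phi>(1)] eq_smult_of_braket[of \<psi> \<phi>] \<psi> G[OF \<phi>(1)] by (simp add: pure_state_def)
qed

section \<open>Schmidt decomposition of two-qubit states\<close>

lemma char_polynomial_2:
  fixes M :: "complex ^ 2 ^ 2"
  shows "char_polynomial M = [:det M, - trace M, 1:]"
  by (simp add: char_polynomial_def det_2 trace_def sum_2)

lemma eigenvalues_desc_2:
  fixes M :: "complex ^ 2 ^ 2"
  assumes "trace M = of_real (a + b)" "det M = of_real (a * b)" "b \<le> a"
  shows "eigenvalues_desc M = [a, b]"
proof -
  have "char_polynomial M = [:- of_real a, 1:] * [:- of_real b, 1:]"
    by (simp add: char_polynomial_2 assms algebra_simps)
  then have "proots (char_polynomial M) = proots [:- of_real a, 1:] + proots [:- of_real b, 1:]"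
    by (simp only: proots_mult pCons_eq_0_iff one_neq_zero simp_thms)
  then have "proots (char_polynomial M) = {#of_real a, of_real b#}" by simp
  moreover have "sorted_list_of_multiset {#a, b#} = [b, a]"
    using assms(3) by auto
  ultimately show ?thesis by (simp add: eigenvalues_desc_def)
qed

text \<open>The smaller root of x^2 - x + C^2/4, the characteristic polynomial of the reduced state
  of a unit vector with concurrence C.\<close>

definition schmidt_min :: "ket2 \<Rightarrow> real" where
  "schmidt_min \<psi> = (1 - sqrt (1 - (concurrence \<psi>)\<^sup>2)) / 2"

lemma concurrence_nonneg: "0 \<le> concurrence \<psi>"
  by (simp add: concurrence_def)

lemma concurrence_le_1: "pure_state \<psi> \<Longrightarrow> concurrence \<psi> \<le> 1"
  using concurrence_le[of \<psi>] by (simp add: pure_state_def)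

lemma concurrence_power2_le_1: "pure_state \<psi> \<Longrightarrow> (concurrence \<psi>)\<^sup>2 \<le> 1"
  using concurrence_le_1 concurrence_nonneg by (simp add: power_le_one)

lemma schmidt_min_bounds:
  assumes "pure_state \<psi>"
  shows "0 \<le> schmidt_min \<psi>" "schmidt_min \<psi> \<le> 1 / 2"
  using concurrence_power2_le_1[OF assms] by (auto simp: schmidt_min_def)

lemma schmidt_min_prod:
  assumes "pure_state \<psi>"
  shows "(1 - schmidt_min \<psi>) * schmidt_min \<psi> = (concurrence \<psi>)\<^sup>2 / 4"
proof -
  have *: "(1 - (1 - s) / 2) * ((1 - s) / 2) = (1 - s\<^sup>2) / 4" for s :: real
    by (simp add: field_simps power2_eq_square)
  show ?thesis
    unfolding schmidt_min_def * using concurrence_power2_le_1[OF assms] by simp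
qed

lemma schmidt_min_mono:
  assumes "pure_state \<phi>" "concurrence \<psi> \<le> concurrence \<phi>"
  shows "schmidt_min \<psi> \<le> schmidt_min \<phi>"
  using power_mono[OF assms(2) concurrence_nonneg, of 2]
  by (simp add: schmidt_min_def)

text \<open>With coefficient matrix M the reduced state is M^T times the conjugate of M: its trace
  is the squared norm and its determinant is |det M|^2 = C^2/4.\<close>

lemma schmidt_coeffs_eq:
  assumes "pure_state \<psi>"
  shows "schmidt_coeffs \<psi> = [1 - schmidt_min \<psi>, schmidt_min \<psi>]"
  unfolding schmidt_coeffs_def
proof (rule eigenvalues_desc_2)
  have "trace (ptrace_A (ketbra \<psi>)) = of_real ((norm \<psi>)\<^sup>2)"
    by (simp add: trace_def ptrace_A_def ketbra_def sum_2 norm_power2_2x2 mult_cnj_self)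
  then show "trace (ptrace_A (ketbra \<psi>)) = of_real (1 - schmidt_min \<psi> + schmidt_min \<psi>)"
    using assms by (simp add: pure_state_def)
  let ?d = "\<psi> $ (1,1) * \<psi> $ (2,2) - \<psi> $ (1,2) * \<psi> $ (2,1)"
  have "cform \<psi> \<psi> = 2 * ?d" by (simp add: cform_def)
  then have "(concurrence \<psi>)\<^sup>2 / 4 = (cmod ?d)\<^sup>2"
    unfolding concurrence_def by (simp only: norm_mult power_mult_distrib) simp
  moreover have "det (ptrace_A (ketbra \<psi>)) = ?d * cnj ?d"
    by (simp add: det_2 ptrace_A_def ketbra_def sum_2 algebra_simps)
  ultimately show "det (ptrace_A (ketbra \<psi>)) = of_real ((1 - schmidt_min \<psi>) * schmidt_min \<psi>)"
    by (simp only: schmidt_min_prod[OF assms] mult_cnj_self of_real_power)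
qed (use schmidt_min_bounds[OF assms] in simp)

text \<open>For (a, b) of unit length and \<epsilon> of modulus one, these are the unitaries with
  first column (a, b); \<epsilon> is the free phase of the second column. The choice
  \<open>rot 0 1 (- 1)\<close> swaps the basis vectors.\<close>

definition rot :: "complex \<Rightarrow> complex \<Rightarrow> complex \<Rightarrow> qubit_op" where
  "rot a b \<epsilon> = (\<chi> i j. if j = 1 then (if i = 1 then a else b)
     else \<epsilon> * (if i = 1 then - cnj b else cnj a))"

lemma unitary_rot:
  assumes "(cmod a)\<^sup>2 + (cmod b)\<^sup>2 = 1" "cmod \<epsilon> = 1"
  shows "unitary (rot a b \<epsilon>)"
proof (rule unitaryI)
  have 1: "a * cnj a + b * cnj b = 1"
    unfolding mult_cnj_self using arg_cong[OF assms(1), of complex_of_real] by simp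
  have 2: "\<epsilon> * cnj \<epsilon> = 1" unfolding mult_cnj_self assms by simp
  have "\<epsilon> * b * (cnj \<epsilon> * cnj b) + \<epsilon> * a * (cnj \<epsilon> * cnj a) = (\<epsilon> * cnj \<epsilon>) * (a * cnj a + b * cnj b)"
    by (simp add: algebra_simps)
  then have "\<epsilon> * b * (cnj \<epsilon> * cnj b) + \<epsilon> * a * (cnj \<epsilon> * cnj a) = 1" unfolding 1 2 by simp
  then show "dagger (rot a b \<epsilon>) ** rot a b \<epsilon> = mat 1"
    using 1 by (simp add: rot_def dagger_def matrix_matrix_mult_def mat_def vec_eq_iff forall_2 sum_2 algebra_simps)
qed

text \<open>A nonzero row is annihilated by its own entries exchanged, one with a sign change; the
  vanishing determinant takes care of the other row.\<close>

lemma singular_2x2_kernel: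
  fixes n11 n12 n21 n22 :: complex
  assumes "n11 * n22 = n12 * n21"
  obtains b1 b2 where "(cmod b1)\<^sup>2 + (cmod b2)\<^sup>2 = 1" "n11 * b1 + n12 * b2 = 0" "n21 * b1 + n22 * b2 = 0"
proof -
  obtain c1 c2 where c: "c1 \<noteq> 0 \<or> c2 \<noteq> 0" "n11 * c1 + n12 * c2 = 0" "n21 * c1 + n22 * c2 = 0"
  proof (cases "n11 = 0 \<and> n12 = 0")
    case False
    then show ?thesis using that[of n12 "- n11"] assms by (auto simp: mult.commute)
  next
    case True
    show ?thesis
    proof (cases "n21 = 0 \<and> n22 = 0")
      case False
      then show ?thesis using that[of n22 "- n21"] True by (auto simp: mult.commute)
    next
      case t: True
      then show ?thesis using that[of 1 0] True by auto
    qed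
  qed
  define r where "r = sqrt ((cmod c1)\<^sup>2 + (cmod c2)\<^sup>2)"
  have "(cmod c1)\<^sup>2 + (cmod c2)\<^sup>2 > 0" using c(1) by (simp add: sum_power2_gt_zero_iff)
  then have r: "r > 0" "r\<^sup>2 = (cmod c1)\<^sup>2 + (cmod c2)\<^sup>2" by (simp_all add: r_def)
  show thesis
  proof
    have "(cmod (c1 / of_real r))\<^sup>2 + (cmod (c2 / of_real r))\<^sup>2 = ((cmod c1)\<^sup>2 + (cmod c2)\<^sup>2) / r\<^sup>2"
      by (simp add: norm_divide power_divide add_divide_distrib)
    then show "(cmod (c1 / of_real r))\<^sup>2 + (cmod (c2 / of_real r))\<^sup>2 = 1" using r c(1) by simp
    have "n11 * (c1 / of_real r) + n12 * (c2 / of_real r) = (n11 * c1 + n12 * c2) / of_real r"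
      by (simp add: add_divide_distrib)
    then show "n11 * (c1 / of_real r) + n12 * (c2 / of_real r) = 0" unfolding c by simp
    have "n21 * (c1 / of_real r) + n22 * (c2 / of_real r) = (n21 * c1 + n22 * c2) / of_real r"
      by (simp add: add_divide_distrib)
    then show "n21 * (c1 / of_real r) + n22 * (c2 / of_real r) = 0" unfolding c by simp
  qed
qed

definition schmidt_ket :: "real \<Rightarrow> real \<Rightarrow> ket2" where
  "schmidt_ket a b = (\<chi> i. if i = (1, 1) then of_real a else if i = (2, 2) then of_real b else 0)"

lemma tensor_op_apply:
  "(tensor_op A B *v (\<psi> :: ket2)) $ (i, j) = A $ i $ 1 * B $ j $ 1 * \<psi> $ (1,1) + A $ i $ 1 * B $ j $ 2 * \<psi> $ (1,2)
     + A $ i $ 2 * B $ j $ 1 * \<psi> $ (2,1) + A $ i $ 2 * B $ j $ 2 * \<psi> $ (2,2)"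
  by (simp add: tensor_op_def matrix_vector_mult_def sum_2x2)

lemma vec_eq_2x2_iff:
  "\<psi> = \<phi> \<longleftrightarrow> \<psi> $ (1,1) = \<phi> $ (1,1) \<and> \<psi> $ (1,2) = \<phi> $ (1,2) \<and> \<psi> $ (2,1) = \<phi> $ (2,1) \<and> \<psi> $ (2,2) = \<phi> $ (2 :: 2, 2 :: 2)"
  by (auto simp: vec_eq_iff forall_2)

lemma transpose_unitary: "unitary U \<Longrightarrow> unitary (transpose U)" for U :: "complex ^ 'n ^ 'n"
proof -
  assume U: "unitary U"
  have "dagger (transpose U) = transpose (dagger U)"
    by (simp add: dagger_def transpose_def vec_eq_iff)
  then show ?thesis
    using U by (simp add: unitary_def matrix_transpose_mul[symmetric] transpose_mat)
qed

text \<open>A singular value decomposition of the coefficient matrix M. The Hermitian matrix H =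
  M^dagger M has trace 1 and determinant l (1 - l), hence eigenvalue 1 - l. Rotating Bob's basis to
  a unit eigenvector makes the columns of M orthogonal with squared lengths 1 - l and l; Alice's
  rotation then aligns them with the axes.\<close>

lemma schmidt_decomposition:
  assumes pure: "pure_state \<psi>"
  obtains U V :: qubit_op where "unitary U" "unitary V"
    "\<psi> = tensor_op U V *v schmidt_ket (sqrt (1 - schmidt_min \<psi>)) (sqrt (schmidt_min \<psi>))"
proof -
  define l where "l = schmidt_min \<psi>"
  have l: "0 \<le> l" "l \<le> 1/2" using schmidt_min_bounds[OF pure] by (auto simp: l_def)
  define m11 m12 m21 m22 where "m11 = \<psi> $ (1,1)" and "m12 = \<psi> $ (1,2)"
    and "m21 = \<psi> $ (2,1)" and "m22 = \<psi> $ (2,2)"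
  define L where "L = complex_of_real (1 - l)"
  define H11 H12 H21 H22 where "H11 = cnj m11 * m11 + cnj m21 * m21"
    and "H12 = cnj m11 * m12 + cnj m21 * m22" and "H21 = cnj m12 * m11 + cnj m22 * m21"
    and "H22 = cnj m12 * m12 + cnj m22 * m22"
  have tr: "H11 + H22 = 1"
  proof -
    have "H11 + H22 = of_real ((norm \<psi>)\<^sup>2)"
      unfolding H11_def H22_def norm_power2_2x2
      by (simp add: cnj_mult_self m11_def m12_def m21_def m22_def)
    then show ?thesis using pure by (simp add: pure_state_def)
  qed
  have det: "H11 * H22 - H12 * H21 = L * (1 - L)"
  proof -
    let ?d = "m11 * m22 - m12 * m21"
    have "cform \<psi> \<psi> = 2 * ?d" by (simp add: cform_def m11_def m12_def m21_def m22_def)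
    then have "(concurrence \<psi>)\<^sup>2 / 4 = (cmod ?d)\<^sup>2"
      unfolding concurrence_def by (simp only: norm_mult power_mult_distrib) simp
    moreover have "H11 * H22 - H12 * H21 = ?d * cnj ?d"
      by (simp add: H11_def H12_def H21_def H22_def algebra_simps)
    moreover have "L * (1 - L) = of_real ((1 - l) * l)" by (simp add: L_def)
    ultimately show ?thesis
      unfolding l_def by (simp only: schmidt_min_prod[OF pure] mult_cnj_self of_real_power)
  qed
  have "(H11 - L) * (H22 - L) = H11 * H22 - L * (H11 + H22) + L * L"
    by (simp add: algebra_simps)
  also have "\<dots> = H12 * H21" using det unfolding tr by (simp add: algebra_simps)
  finally obtain b1 b2 where b: "(cmod b1)\<^sup>2 + (cmod b2)\<^sup>2 = 1"
      "(H11 - L) * b1 + H12 * b2 = 0" "H21 * b1 + (H22 - L) * b2 = 0"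
    by (rule singular_2x2_kernel)
  have bb: "cnj b1 * b1 + cnj b2 * b2 = 1"
    unfolding cnj_mult_self using arg_cong[OF b(1), of complex_of_real] by simp
  \<comment> \<open>Bob's operator acts on the coefficient matrix from the right by its transpose,
    so this choice makes M times the eigenvector the first column.\<close>
  define W where "W = transpose (rot b1 b2 1)"
  have W: "unitary W" unfolding W_def using b(1) by (intro transpose_unitary unitary_rot) auto
  define \<phi> where "\<phi> = tensor_op (mat 1) W *v \<psi>"
  define n11 n21 n12 n22 where "n11 = m11 * b1 + m12 * b2" and "n21 = m21 * b1 + m22 * b2"
    and "n12 = m12 * cnj b1 - m11 * cnj b2" and "n22 = m22 * cnj b1 - m21 * cnj b2"
  have \<phi>: "\<phi> $ (1,1) = n11" "\<phi> $ (1,2) = n12" "\<phi> $ (2,1) = n21" "\<phi> $ (2,2) = n22"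
    by (simp_all add: \<phi>_def tensor_op_apply W_def transpose_def rot_def mat_def
        m11_def m12_def m21_def m22_def n11_def n12_def n21_def n22_def algebra_simps)
  have norm\<phi>: "norm \<phi> = 1"
    unfolding \<phi>_def using pure by (simp add: norm_unitary unitary_tensor_op W pure_state_def)
  have eig: "H11 * b1 + H12 * b2 = L * b1" "H21 * b1 + H22 * b2 = L * b2"
    using b(2,3) by (simp_all add: algebra_simps)
  have "cnj n11 * n11 + cnj n21 * n21 = cnj b1 * (H11 * b1 + H12 * b2) + cnj b2 * (H21 * b1 + H22 * b2)"
    by (simp add: n11_def n21_def H11_def H12_def H21_def H22_def algebra_simps)
  also have "\<dots> = L * (cnj b1 * b1 + cnj b2 * b2)" unfolding eig by (simp add: algebra_simps)
  finally have "cnj n11 * n11 + cnj n21 * n21 = L" unfolding bb by simp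
  then have "complex_of_real ((cmod n11)\<^sup>2 + (cmod n21)\<^sup>2) = of_real (1 - l)"
    by (simp add: cnj_mult_self L_def)
  then have n1: "(cmod n11)\<^sup>2 + (cmod n21)\<^sup>2 = 1 - l" using of_real_eq_iff by blast
  have "cnj n12 * n11 + cnj n22 * n21 = b1 * (H21 * b1 + H22 * b2) - b2 * (H11 * b1 + H12 * b2)"
    by (simp add: n11_def n21_def n12_def n22_def H11_def H12_def H21_def H22_def algebra_simps)
  also have "\<dots> = 0" unfolding eig by (simp add: algebra_simps)
  finally have "cnj (cnj n12 * n11 + cnj n22 * n21) = 0" by simp
  then have orth: "cnj n11 * n12 + cnj n21 * n22 = 0" by (simp add: mult.commute)
  have n2: "(cmod n12)\<^sup>2 + (cmod n22)\<^sup>2 = l"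
  proof -
    have "(norm \<phi>)\<^sup>2 = ((cmod n11)\<^sup>2 + (cmod n21)\<^sup>2) + ((cmod n12)\<^sup>2 + (cmod n22)\<^sup>2)"
      by (simp add: norm_power2_2x2 \<phi>)
    then show ?thesis unfolding n1 norm\<phi> by simp
  qed
  \<comment> \<open>Only the longer column is normalized: 1 - l is at least 1/2, while l may
    vanish.\<close>
  define s where "s = sqrt (1 - l)"
  have s: "s > 0" "s\<^sup>2 = 1 - l" using l by (auto simp: s_def)
  define u1 u2 where "u1 = n11 / of_real s" and "u2 = n21 / of_real s"
  have n: "n11 = of_real s * u1" "n21 = of_real s * u2" using s by (auto simp: u1_def u2_def)
  have "(cmod u1)\<^sup>2 + (cmod u2)\<^sup>2 = ((cmod n11)\<^sup>2 + (cmod n21)\<^sup>2) / s\<^sup>2"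
    by (simp add: u1_def u2_def norm_divide power_divide add_divide_distrib)
  then have u: "(cmod u1)\<^sup>2 + (cmod u2)\<^sup>2 = 1" using s l unfolding n1 by simp
  have uu: "u1 * cnj u1 + u2 * cnj u2 = 1"
    unfolding mult_cnj_self using arg_cong[OF u, of complex_of_real] by simp
  have "of_real s * (cnj u1 * n12 + cnj u2 * n22) = 0"
    using orth unfolding n by (simp add: algebra_simps)
  then have orth': "cnj u1 * n12 + cnj u2 * n22 = 0" using s by simp
  \<comment> \<open>In dimension two, orthogonality to u leaves the second column a multiple of (-
    cnj u2, cnj u1); \<kappa> is its coordinate, of modulus sqrt l, and its phase goes into Alice's
    rotation.\<close>
  define \<kappa> where "\<kappa> = u1 * n22 - u2 * n12"
  have "\<kappa> * - cnj u2 = (u1 * cnj u1 + u2 * cnj u2) * n12 - u1 * (cnj u1 * n12 + cnj u2 * n22)"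
    by (simp add: \<kappa>_def algebra_simps)
  then have k1: "n12 = \<kappa> * - cnj u2" unfolding uu orth' by simp
  have "\<kappa> * cnj u1 = (u1 * cnj u1 + u2 * cnj u2) * n22 - u2 * (cnj u1 * n12 + cnj u2 * n22)"
    by (simp add: \<kappa>_def algebra_simps)
  then have k2: "n22 = \<kappa> * cnj u1" unfolding uu orth' by simp
  have "(cmod \<kappa>)\<^sup>2 * ((cmod u1)\<^sup>2 + (cmod u2)\<^sup>2) = l"
    unfolding n2[symmetric] k1 k2 by (simp add: norm_mult power_mult_distrib algebra_simps)
  then have "(cmod \<kappa>)\<^sup>2 = l" unfolding u by simp
  then have \<kappa>: "cmod \<kappa> = sqrt l" by (metis norm_ge_zero real_sqrt_unique)
  define \<epsilon> where "\<epsilon> = (if \<kappa> = 0 then 1 else sgn \<kappa>)"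
  have \<epsilon>: "cmod \<epsilon> = 1" "of_real (sqrt l) * \<epsilon> = \<kappa>"
    unfolding \<kappa>[symmetric] by (simp_all add: \<epsilon>_def sgn_eq norm_divide)
  have "\<phi> = tensor_op (rot u1 u2 \<epsilon>) (mat 1) *v schmidt_ket s (sqrt l)"
  proof -
    have "n12 = of_real (sqrt l) * \<epsilon> * - cnj u2" "n22 = of_real (sqrt l) * \<epsilon> * cnj u1"
      unfolding \<epsilon>(2) by (rule k1 k2)+
    then show ?thesis
      unfolding vec_eq_2x2_iff \<phi> tensor_op_apply using n
      by (simp add: rot_def schmidt_ket_def mat_def)
  qed
  moreover have "\<psi> = tensor_op (mat 1) (dagger W) *v \<phi>"
    using W by (simp add: \<phi>_def matrix_vector_mul_assoc tensor_op_mult unitary_def tensor_op_mat_1)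
  ultimately have "\<psi> = tensor_op (rot u1 u2 \<epsilon>) (dagger W) *v schmidt_ket s (sqrt l)"
    by (simp add: matrix_vector_mul_assoc tensor_op_mult)
  then show thesis
    using that[of "rot u1 u2 \<epsilon>" "dagger W"] unitary_rot[OF u \<epsilon>(1)] unitary_dagger[OF W]
    by (simp add: s_def l_def)
qed

lemma concurrence_schmidt_ket: "0 \<le> a \<Longrightarrow> 0 \<le> b \<Longrightarrow> concurrence (schmidt_ket a b) = 2 * (a * b)"
  by (simp add: concurrence_def cform_def schmidt_ket_def norm_mult)

lemma pure_state_schmidt_ket: "pure_state (schmidt_ket a b) \<longleftrightarrow> a\<^sup>2 + b\<^sup>2 = 1"
proof -
  have "(norm (schmidt_ket a b))\<^sup>2 = a\<^sup>2 + b\<^sup>2"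
    by (simp add: norm_power2_2x2 schmidt_ket_def)
  then show ?thesis unfolding pure_state_def by (metis abs_norm_cancel abs_square_eq_1)
qed

section \<open>Reachable mixtures\<close>

text \<open>A down-set for the concurrence. It is automatically invariant under phases and local
  unitaries, which preserve the concurrence.\<close>

definition down_closed :: "ket2 set \<Rightarrow> bool" where
  "down_closed G \<longleftrightarrow> (\<forall>\<psi>\<in>G. pure_state \<psi>) \<and>
     (\<forall>\<psi>\<in>G. \<forall>\<phi>. pure_state \<phi> \<and> concurrence \<phi> \<le> concurrence \<psi> \<longrightarrow> \<phi> \<in> G)"

definition real_diag :: "real \<Rightarrow> real \<Rightarrow> qubit_op" where
  "real_diag a b = (\<chi> i j. if i = j then of_real (if i = 1 then a else b) else 0)"

lemma real_diag_mult: "real_diag a b ** real_diag c d = real_diag (a * c) (b * d)"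
  by (simp add: real_diag_def matrix_matrix_mult_def vec_eq_iff forall_2 sum_2)

lemma dagger_real_diag: "dagger (real_diag a b) = real_diag a b"
  by (simp add: real_diag_def dagger_def vec_eq_iff forall_2)

lemma sum_real_diag: "(\<Sum>i\<in>I. real_diag (a i) (b i)) = real_diag (\<Sum>i\<in>I. a i) (\<Sum>i\<in>I. b i)"
  by (simp add: real_diag_def vec_eq_iff forall_2)

lemma real_diag_1: "real_diag 1 1 = mat 1"
  by (simp add: real_diag_def mat_def vec_eq_iff)

lemma real_diag_smult: "tensor_op (U ** real_diag (c * a) (c * b)) V *v (\<psi> :: ket2) = of_real c *s (tensor_op (U ** real_diag a b) V *v \<psi>)"
  by (simp add: vec_eq_2x2_iff tensor_op_apply matrix_matrix_mult_def real_diag_def sum_2 algebra_simps)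

lemma tensor_op_real_diag_schmidt_ket:
  "tensor_op (U ** real_diag a b) V *v schmidt_ket c d = tensor_op U V *v schmidt_ket (a * c) (b * d)"
  by (simp add: vec_eq_2x2_iff tensor_op_apply matrix_matrix_mult_def real_diag_def schmidt_ket_def sum_2)

lemma schmidt_ket_scale: "schmidt_ket (c * a) (c * b) = of_real c *s schmidt_ket a b"
  by (simp add: vec_eq_2x2_iff schmidt_ket_def)

lemma schmidt_ket_swap:
  "tensor_op (rot 0 1 (- 1)) (rot 0 1 (- 1)) *v schmidt_ket a b = schmidt_ket b a"
  by (simp add: vec_eq_2x2_iff tensor_op_apply schmidt_ket_def rot_def)

text \<open>Outputs of protocols with real diagonal Kraus operators. This shape allows protocols to
  be joined: two commuting families need not commute with each other, but diagonal ones do.\<close>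

definition diag_reach :: "ket2 \<Rightarrow> op2 set" where
  "diag_reach \<psi> = {\<rho>. \<exists>(n::nat) a b U V. (\<Sum>i<n. (a i)\<^sup>2) = 1 \<and> (\<Sum>i<n. (b i)\<^sup>2) = 1 \<and>
     (\<forall>i<n. unitary (U i) \<and> unitary (V i)) \<and>
     \<rho> = (\<Sum>i<n. ketbra (tensor_op (U i ** real_diag (a i) (b i)) (V i) *v \<psi>))}"

lemma diag_reach_LOCC1A:
  assumes "\<rho> \<in> diag_reach \<psi>"
  shows "\<exists>\<L>\<in>LOCC1A. \<rho> = \<L> (ketbra \<psi>)"
proof -
  obtain n :: nat and a b U V where *: "(\<Sum>i<n. (a i)\<^sup>2) = 1" "(\<Sum>i<n. (b i)\<^sup>2) = 1"
    "\<forall>i<n. unitary (U i) \<and> unitary (V i)"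
    "\<rho> = (\<Sum>i<n. ketbra (tensor_op (U i ** real_diag (a i) (b i)) (V i) *v \<psi>))"
    using assms unfolding diag_reach_def by blast
  define A where "A i = real_diag (a i) (b i)" for i
  define \<L> where "\<L> = (\<lambda>\<sigma>. \<Sum>i<n.
       tensor_op (U i ** A i) (V i) ** \<sigma> ** dagger (tensor_op (U i ** A i) (V i)))"
  have "(\<Sum>i<n. dagger (A i) ** A i) = mat 1"
    using *(1,2) by (simp add: A_def dagger_real_diag real_diag_mult sum_real_diag real_diag_1 flip: power2_eq_square)
  moreover have "A i ** A j = A j ** A i" for i j
    by (simp add: A_def real_diag_mult mult.commute)
  ultimately have "\<L> \<in> LOCC1A"
    unfolding LOCC1A_def \<L>_def using *(3) by blast
  moreover have "\<rho> = \<L> (ketbra \<psi>)"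
    unfolding *(4) \<L>_def A_def ketbra_image ..
  ultimately show ?thesis by blast
qed

lemma sum_lessThan_append:
  fixes f g :: "nat \<Rightarrow> 'a::comm_monoid_add"
  shows "(\<Sum>k<n + m. if k < n then f k else g (k - n)) = (\<Sum>k<n. f k) + (\<Sum>k<m. g k)"
  by (induction m) (simp_all add: add.assoc)

text \<open>Flip a coin with weights x and y and run one of the two protocols; the coin enters
  Alice's Kraus operators as the factors sqrt x and sqrt y, and the outcome index runs over both
  families.\<close>

lemma convex_diag_reach: "convex (diag_reach \<psi>)"
proof (rule convexI)
  fix \<rho> \<rho>' and x y :: real
  assume \<rho>: "\<rho> \<in> diag_reach \<psi>" and \<rho>': "\<rho>' \<in> diag_reach \<psi>" and xy: "0 \<le> x" "0 \<le> y" "x + y = 1"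
  obtain n :: nat and a b U V where 1: "(\<Sum>i<n. (a i)\<^sup>2) = 1" "(\<Sum>i<n. (b i)\<^sup>2) = 1"
    "\<And>i. i < n \<Longrightarrow> unitary (U i)" "\<And>i. i < n \<Longrightarrow> unitary (V i)"
    "\<rho> = (\<Sum>i<n. ketbra (tensor_op (U i ** real_diag (a i) (b i)) (V i) *v \<psi>))"
    using \<rho> unfolding diag_reach_def by blast
  obtain m :: nat and c d P Q where 2: "(\<Sum>i<m. (c i)\<^sup>2) = 1" "(\<Sum>i<m. (d i)\<^sup>2) = 1"
    "\<And>i. i < m \<Longrightarrow> unitary (P i)" "\<And>i. i < m \<Longrightarrow> unitary (Q i)"
    "\<rho>' = (\<Sum>i<m. ketbra (tensor_op (P i ** real_diag (c i) (d i)) (Q i) *v \<psi>))"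
    using \<rho>' unfolding diag_reach_def by blast
  define a' where "a' k = (if k < n then sqrt x * a k else sqrt y * c (k - n))" for k
  define b' where "b' k = (if k < n then sqrt x * b k else sqrt y * d (k - n))" for k
  define U' where "U' k = (if k < n then U k else P (k - n))" for k
  define V' where "V' k = (if k < n then V k else Q (k - n))" for k
  have "(\<Sum>k<n+m. (a' k)\<^sup>2) = (\<Sum>k<n+m. if k < n then x * (a k)\<^sup>2 else y * (c (k - n))\<^sup>2)"
    using xy by (intro sum.cong) (auto simp: a'_def power_mult_distrib)
  also have "\<dots> = x * (\<Sum>k<n. (a k)\<^sup>2) + y * (\<Sum>k<m. (c k)\<^sup>2)"
    unfolding sum_distrib_left by (rule sum_lessThan_append[where g = "\<lambda>k. y * (c k)\<^sup>2"])
  finally have a': "(\<Sum>k<n+m. (a' k)\<^sup>2) = 1" using 1 2 xy by simp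
  have "(\<Sum>k<n+m. (b' k)\<^sup>2) = (\<Sum>k<n+m. if k < n then x * (b k)\<^sup>2 else y * (d (k - n))\<^sup>2)"
    using xy by (intro sum.cong) (auto simp: b'_def power_mult_distrib)
  also have "\<dots> = x * (\<Sum>k<n. (b k)\<^sup>2) + y * (\<Sum>k<m. (d k)\<^sup>2)"
    unfolding sum_distrib_left by (rule sum_lessThan_append[where g = "\<lambda>k. y * (d k)\<^sup>2"])
  finally have b': "(\<Sum>k<n+m. (b' k)\<^sup>2) = 1" using 1 2 xy by simp
  have UV: "\<forall>k<n+m. unitary (U' k) \<and> unitary (V' k)"
    using 1(3,4) 2(3,4) by (simp add: U'_def V'_def)
  have "(\<Sum>k<n+m. ketbra (tensor_op (U' k ** real_diag (a' k) (b' k)) (V' k) *v \<psi>))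
    = (\<Sum>k<n+m. if k < n then x *\<^sub>R ketbra (tensor_op (U k ** real_diag (a k) (b k)) (V k) *v \<psi>)
        else y *\<^sub>R ketbra (tensor_op (P (k - n) ** real_diag (c (k - n)) (d (k - n))) (Q (k - n)) *v \<psi>))"
    using xy by (intro sum.cong)
      (auto simp: U'_def V'_def a'_def b'_def real_diag_smult ketbra_smult)
  also have "\<dots> = x *\<^sub>R \<rho> + y *\<^sub>R \<rho>'"
    unfolding 1(5) 2(5) scaleR_sum_right
    by (rule sum_lessThan_append[where g = "\<lambda>k. y *\<^sub>R ketbra (tensor_op (P k ** real_diag (c k) (d k)) (Q k) *v \<psi>)"])
  finally show "x *\<^sub>R \<rho> + y *\<^sub>R \<rho>' \<in> diag_reach \<psi>"
    unfolding diag_reach_def mem_Collect_eq using a' b' UV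
    by (intro exI[of _ "n + m"] exI[of _ a'] exI[of _ b'] exI[of _ U'] exI[of _ V'] conjI) simp_all
qed

text \<open>
  Nielsen's protocol: the two outcomes leave the target, respectively the target with its Schmidt
  coefficients swapped, and the weight \<open>t\<close> makes the Kraus operators complete.
\<close>

lemma ketbra_in_diag_reach:
  assumes \<phi>: "pure_state \<phi>" and L: "schmidt_min \<phi> \<le> L" "L \<le> 1 / 2"
  shows "ketbra \<phi> \<in> diag_reach (schmidt_ket (sqrt (1 - L)) (sqrt L))"
proof -
  define l where "l = schmidt_min \<phi>"
  have l: "0 \<le> l" "l \<le> L" using schmidt_min_bounds[OF \<phi>] L by (auto simp: l_def)
  obtain U V :: qubit_op where U: "unitary U" and V: "unitary V"
    and \<phi>_eq: "\<phi> = tensor_op U V *v schmidt_ket (sqrt (1 - l)) (sqrt l)"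
    using schmidt_decomposition[OF \<phi>] unfolding l_def by blast
  show ?thesis
  proof (cases "l = L")
    \<comment> \<open>Kept apart because l = 1/2 would make the denominator of \<open>t\<close>
      vanish, and L = 0 that of some Kraus entries; either forces l = L.\<close>
    case True
    have "ketbra \<phi> = (\<Sum>i<1::nat. ketbra (tensor_op (U ** real_diag 1 1) V
        *v schmidt_ket (sqrt (1 - L)) (sqrt L)))"
      using True by (simp add: \<phi>_eq real_diag_1)
    then show ?thesis unfolding diag_reach_def mem_Collect_eq using U V
      by (intro exI[of _ 1] exI[of _ "\<lambda>_. 1"] exI[of _ "\<lambda>_. U"] exI[of _ "\<lambda>_. V"]) simp
  next
    case False
    then have lL: "l < L" "l < 1/2" "0 < L" "L < 1" using l L by auto
    \<comment> \<open>The weight solves t (1 - l) + (1 - t) l = 1 - L: the larger coefficient of the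
      source is an average of the two coefficients of the target.\<close>
    define t where "t = (1 - l - L) / (1 - 2 * l)"
    have t: "0 \<le> t" "t \<le> 1" "t * (1 - 2 * l) = 1 - l - L"
      using lL L l by (auto simp: t_def field_simps)
    define X where "X = rot 0 1 (- 1)"
    have X: "unitary X" unfolding X_def by (rule unitary_rot) auto
    \<comment> \<open>Each entry is the square root of weight times target coefficient over source
      coefficient, with the target coefficients exchanged for the second outcome.\<close>
    define a0 b0 a1 b1 where "a0 = sqrt (t * (1 - l) / (1 - L))" and "b0 = sqrt (t * l / L)"
      and "a1 = sqrt ((1 - t) * l / (1 - L))" and "b1 = sqrt ((1 - t) * (1 - l) / L)"
    have "a0\<^sup>2 + a1\<^sup>2 = (t * (1 - l) + (1 - t) * l) / (1 - L)"
      using t l lL by (simp add: a0_def a1_def add_divide_distrib)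
    also have "t * (1 - l) + (1 - t) * l = 1 - L" using t(3) by (simp add: algebra_simps)
    finally have a: "a0\<^sup>2 + a1\<^sup>2 = 1" using lL by simp
    have "b0\<^sup>2 + b1\<^sup>2 = (t * l + (1 - t) * (1 - l)) / L"
      using t l lL by (simp add: b0_def b1_def add_divide_distrib)
    also have "t * l + (1 - t) * (1 - l) = L" using t(3) by (simp add: algebra_simps)
    finally have b: "b0\<^sup>2 + b1\<^sup>2 = 1" using lL by simp
    have prods: "a0 * sqrt (1 - L) = sqrt t * sqrt (1 - l)" "b0 * sqrt L = sqrt t * sqrt l"
      "a1 * sqrt (1 - L) = sqrt (1 - t) * sqrt l" "b1 * sqrt L = sqrt (1 - t) * sqrt (1 - l)"
      using lL by (simp_all add: a0_def a1_def b0_def b1_def flip: real_sqrt_mult)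
    have out0: "tensor_op (U ** real_diag a0 b0) V *v schmidt_ket (sqrt (1 - L)) (sqrt L)
        = of_real (sqrt t) *s \<phi>"
      unfolding tensor_op_real_diag_schmidt_ket prods schmidt_ket_scale \<phi>_eq
      by (simp add: vector_scalar_commute)
    have out1: "tensor_op (U ** X ** real_diag a1 b1) (V ** X) *v schmidt_ket (sqrt (1 - L)) (sqrt L)
        = of_real (sqrt (1 - t)) *s \<phi>"
      unfolding tensor_op_real_diag_schmidt_ket prods schmidt_ket_scale \<phi>_eq
      by (simp add: vector_scalar_commute tensor_op_mult[symmetric] matrix_vector_mul_assoc[symmetric]
          X_def schmidt_ket_swap)
    let ?a = "\<lambda>i::nat. if i = 0 then a0 else a1" and ?b = "\<lambda>i::nat. if i = 0 then b0 else b1"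
    let ?U = "\<lambda>i::nat. if i = 0 then U else U ** X" and ?V = "\<lambda>i::nat. if i = 0 then V else V ** X"
    have two: "(\<Sum>i<2::nat. f i) = f 0 + f 1" for f :: "nat \<Rightarrow> 'z::comm_monoid_add"
      by (simp add: numeral_2_eq_2)
    have "ketbra \<phi> = t *\<^sub>R ketbra \<phi> + (1 - t) *\<^sub>R ketbra \<phi>" by (simp flip: scaleR_left_distrib)
    also have "\<dots> = (\<Sum>i<2. ketbra (tensor_op (?U i ** real_diag (?a i) (?b i)) (?V i)
        *v schmidt_ket (sqrt (1 - L)) (sqrt L)))"
      unfolding two using t by (simp add: out0 out1 ketbra_smult)
    finally have "ketbra \<phi> = (\<Sum>i<2. ketbra (tensor_op (?U i ** real_diag (?a i) (?b i)) (?V i)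
        *v schmidt_ket (sqrt (1 - L)) (sqrt L)))" .
    moreover have "(\<Sum>i<2. (?a i)\<^sup>2) = 1" "(\<Sum>i<2. (?b i)\<^sup>2) = 1" unfolding two using a b by simp_all
    moreover have "\<forall>i<2. unitary (?U i) \<and> unitary (?V i)" using U V X by (simp add: unitary_mult)
    ultimately show ?thesis
      unfolding diag_reach_def mem_Collect_eq
      by (intro exI[of _ 2] exI[of _ ?a] exI[of _ ?b] exI[of _ ?U] exI[of _ ?V] conjI)
  qed
qed

lemma hull_subset_locc_plus:
  assumes G: "down_closed G" and \<rho>: "\<rho> \<in> convex hull (ketbra ` G)"
  shows "\<rho> \<in> locc_plus (convex hull (ketbra ` G))"
proof -
  \<comment> \<open>Caratheodory reduces to finitely many generators, so the largest
    \<open>schmidt_min\<close> among them is attained by a member of \<open>G\<close>.\<close>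
  obtain S where S: "finite S" "S \<subseteq> ketbra ` G" "\<rho> \<in> convex hull S"
    using \<rho> unfolding caratheodory[of "ketbra ` G"] by blast
  then obtain C where C: "C \<subseteq> G" "finite C" "S = ketbra ` C"
    by (meson finite_subset_image)
  have "C \<noteq> {}" using S(3) C(3) by auto
  define L where "L = Max (schmidt_min ` C)"
  have "L \<in> schmidt_min ` C" unfolding L_def using \<open>C \<noteq> {}\<close> C(2) by (intro Max_in) auto
  then obtain \<theta> where \<theta>: "\<theta> \<in> C" "L = schmidt_min \<theta>" by auto
  have pure: "\<phi> \<in> C \<Longrightarrow> pure_state \<phi>" for \<phi> using C(1) G by (auto simp: down_closed_def)
  have L: "0 \<le> L" "L \<le> 1/2" using schmidt_min_bounds[OF pure] \<theta> by auto
  define \<psi> where "\<psi> = schmidt_ket (sqrt (1 - L)) (sqrt L)"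
  have \<psi>: "pure_state \<psi>" using L by (simp add: \<psi>_def pure_state_schmidt_ket)
  have "(concurrence \<psi>)\<^sup>2 = 4 * ((1 - L) * L)"
    using L by (simp add: \<psi>_def concurrence_schmidt_ket power_mult_distrib)
  also have "\<dots> = (concurrence \<theta>)\<^sup>2"
    unfolding \<theta>(2) schmidt_min_prod[OF pure[OF \<theta>(1)]] by simp
  finally have "concurrence \<psi> = concurrence \<theta>"
    using concurrence_nonneg by (simp add: power2_eq_iff_nonneg)
  then have "\<psi> \<in> G" using G \<theta>(1) C(1) \<psi> unfolding down_closed_def by fastforce
  have "ketbra ` C \<subseteq> diag_reach \<psi>"
  proof safe
    fix \<phi> assume \<phi>: "\<phi> \<in> C"
    then have "schmidt_min \<phi> \<le> L" unfolding L_def using C(2) by (intro Max_ge) auto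
    then show "ketbra \<phi> \<in> diag_reach \<psi>"
      unfolding \<psi>_def using pure[OF \<phi>] L by (intro ketbra_in_diag_reach)
  qed
  then have "convex hull S \<subseteq> diag_reach \<psi>"
    unfolding C(3) by (intro hull_minimal convex_diag_reach)
  then have "\<rho> \<in> diag_reach \<psi>" using S(3) by blast
  then obtain \<L> where "\<L> \<in> LOCC1A" "\<rho> = \<L> (ketbra \<psi>)" using diag_reach_LOCC1A by blast
  then show ?thesis
    unfolding locc_plus_def using \<psi> hull_inc[OF imageI[OF \<open>\<psi> \<in> G\<close>], of ketbra convex] by blast
qed

text \<open>Pure states are extreme, so a pure state in the hull is a generator up to a phase, and
  the phase does not change the concurrence.\<close>

lemma pure_in_hull_iff:
  assumes G: "down_closed G" and \<psi>: "pure_state \<psi>"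
  shows "ketbra \<psi> \<in> convex hull (ketbra ` G) \<longleftrightarrow> \<psi> \<in> G"
proof
  assume "ketbra \<psi> \<in> convex hull (ketbra ` G)"
  then obtain \<phi> c where \<phi>: "\<phi> \<in> G" "\<phi> = c *s \<psi>" "cmod c = 1"
    using pure_in_hull[OF \<psi>] G unfolding down_closed_def by metis
  then have "concurrence \<psi> = concurrence \<phi>" by (simp add: concurrence_smult)
  then show "\<psi> \<in> G" using \<phi>(1) \<psi> G unfolding down_closed_def by fastforce
qed (simp add: hull_inc)

lemma locc_plus_hull:
  assumes G: "down_closed G"
  shows "locc_plus (convex hull (ketbra ` G)) = convex hull (ketbra ` G)"
proof
  show "convex hull (ketbra ` G) \<subseteq> locc_plus (convex hull (ketbra ` G))"
    using hull_subset_locc_plus[OF G] by blast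
  show "locc_plus (convex hull (ketbra ` G)) \<subseteq> convex hull (ketbra ` G)"
  proof
    fix \<rho> assume "\<rho> \<in> locc_plus (convex hull (ketbra ` G))"
    then obtain \<L> \<psi> where \<rho>: "\<rho> = \<L> (ketbra \<psi>)" "\<L> \<in> LOCC1A" "pure_state \<psi>"
        "ketbra \<psi> \<in> convex hull (ketbra ` G)"
      unfolding locc_plus_def by blast
    then have "\<psi> \<in> G" using pure_in_hull_iff[OF G] by blast
    then have "{\<phi>. pure_state \<phi> \<and> concurrence \<phi> \<le> concurrence \<psi>} \<subseteq> G"
      using G unfolding down_closed_def by blast
    then show "\<rho> \<in> convex hull (ketbra ` G)"
      unfolding \<rho>(1) using LOCC1A_ketbra_in_hull[OF \<rho>(2,3)] by (meson hull_mono image_mono subsetD)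
  qed
qed

section \<open>States with large overlap with a down-set\<close>

lemma local_unitary_equivalence:
  assumes "pure_state \<psi>" "pure_state \<phi>" "concurrence \<psi> = concurrence \<phi>"
  obtains U V :: qubit_op where "unitary U" "unitary V" "\<phi> = tensor_op U V *v \<psi>"
proof -
  obtain P Q R T :: qubit_op where *: "unitary P" "unitary Q" "unitary R" "unitary T"
    "\<psi> = tensor_op P Q *v schmidt_ket (sqrt (1 - schmidt_min \<psi>)) (sqrt (schmidt_min \<psi>))"
    "\<phi> = tensor_op R T *v schmidt_ket (sqrt (1 - schmidt_min \<phi>)) (sqrt (schmidt_min \<phi>))"
    using schmidt_decomposition assms(1,2) by metis
  define D where "D = schmidt_ket (sqrt (1 - schmidt_min \<psi>)) (sqrt (schmidt_min \<psi>))"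
  have D: "\<psi> = tensor_op P Q *v D" "\<phi> = tensor_op R T *v D"
    using *(5,6) assms(3) by (simp_all add: D_def schmidt_min_def)
  have "tensor_op (R ** dagger P) (T ** dagger Q) *v \<psi> = tensor_op R T *v D"
    using *(1,2) unfolding D(1)
    by (simp add: matrix_vector_mul_assoc tensor_op_mult matrix_mul_assoc[symmetric] unitary_def)
  then show thesis
    using that[of "R ** dagger P" "T ** dagger Q"] * D(2) by (simp add: unitary_mult unitary_dagger)
qed

text \<open>
  The witness lies on the geodesic from \<open>\<psi>\<close> to \<open>\<xi>\<close>, along which the overlap with \<open>\<xi>\<close> does not
  decrease.
\<close>

lemma geodesic_concurrence:
  assumes \<psi>: "pure_state \<psi>" and \<xi>: "pure_state \<xi>"
    and c: "concurrence \<xi> \<le> c" "c \<le> concurrence \<psi>"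
  obtains \<theta> where "pure_state \<theta>" "concurrence \<theta> = c" "cmod (braket \<xi> \<psi>) \<le> cmod (braket \<xi> \<theta>)"
proof -
  define z where "z = braket \<xi> \<psi>"
  define k where "k = cmod z"
  \<comment> \<open>A phase correction of \<xi> that makes its overlap with \<psi> real and
    nonnegative; otherwise the segment could pass through 0.\<close>
  define \<omega> where "\<omega> = (if z = 0 then 1 else sgn z)"
  have \<omega>: "cmod \<omega> = 1" by (simp add: \<omega>_def norm_sgn)
  have \<omega>z: "cnj \<omega> * z = of_real k"
  proof -
    have "of_real k * \<omega> = z" by (simp add: \<omega>_def k_def sgn_eq)
    then have "cnj \<omega> * z = (cnj \<omega> * \<omega>) * of_real k" by (simp add: algebra_simps)
    then show ?thesis by (simp add: cnj_mult_self \<omega>)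
  qed
  define \<eta> where "\<eta> = \<omega> *s \<xi>"
  have \<eta>: "norm \<eta> = 1" "concurrence \<eta> = concurrence \<xi>" "braket \<eta> \<psi> = of_real k"
    using \<xi> \<omega> \<omega>z by (simp_all add: \<eta>_def norm_smult_complex pure_state_def concurrence_smult
        braket_smult_left z_def)
  have n\<psi>: "norm \<psi> = 1" using \<psi> by (simp add: pure_state_def)
  define \<gamma> where "\<gamma> t = of_real (1 - t) *s \<psi> + of_real t *s \<eta>" for t
  define N where "N t = (1 - t)\<^sup>2 + t\<^sup>2 + 2 * (t * (1 - t)) * k" for t :: real
  have N: "(norm (\<gamma> t))\<^sup>2 = N t" for t
    unfolding \<gamma>_def norm_power2_comb \<eta> n\<psi> norm_of_real power2_abs
    by (simp add: N_def algebra_simps)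
  \<comment> \<open>The segment is not normalized, so the concurrence is compared with c times the
    squared norm, which keeps division out of the continuity argument.\<close>
  have "\<exists>t\<ge>0. t \<le> 1 \<and> concurrence (\<gamma> t) - c * N t = 0"
  proof (rule IVT2')
    show "concurrence (\<gamma> 1) - c * N 1 \<le> 0" using c \<eta>(2) by (simp add: \<gamma>_def N_def)
    show "0 \<le> concurrence (\<gamma> 0) - c * N 0" using c by (simp add: \<gamma>_def N_def)
    show "continuous_on {0..1} (\<lambda>t. concurrence (\<gamma> t) - c * N t)"
      unfolding concurrence_def cform_def \<gamma>_def N_def vector_add_component vector_smult_component
      by (intro continuous_intros)
  qed simp
  then obtain t where t: "0 \<le> t" "t \<le> 1" "concurrence (\<gamma> t) = c * N t" by auto
  have k: "0 \<le> k" by (simp add: k_def)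
  have "(1 - t)\<^sup>2 + t\<^sup>2 > 0" by (cases "t = 0") (simp_all add: add_nonneg_pos)
  then have Npos: "N t > 0" using t k by (simp add: N_def add_pos_nonneg)
  define s where "s = norm (\<gamma> t)"
  have s: "s > 0" "s\<^sup>2 = N t" using N[of t] Npos by (auto simp: s_def)
  define \<theta> where "\<theta> = of_real (inverse s) *s \<gamma> t"
  have 1: "pure_state \<theta>"
    using s(1) by (simp add: \<theta>_def pure_state_def norm_smult_complex norm_inverse flip: s_def)
  have 2: "concurrence \<theta> = c"
    using s Npos by (simp add: \<theta>_def concurrence_smult t(3) norm_inverse power_inverse)
  have "k \<le> 1"
  proof (rule ccontr)
    assume "\<not> k \<le> 1"
    then have "cmod (braket \<psi> \<xi>) \<ge> 1" unfolding k_def z_def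
      by (metis cnj_braket complex_mod_cnj less_eq_real_def linorder_not_le)
    then have "cmod (braket \<psi> \<xi>) = 1"
      using eq_smult_of_braket(2)[of \<psi> \<xi>] \<psi> \<xi> by (simp add: pure_state_def)
    then show False using \<open>\<not> k \<le> 1\<close> unfolding k_def z_def
      by (metis cnj_braket complex_mod_cnj order_refl)
  qed
  then have k2: "k\<^sup>2 \<le> 1" using k by (simp add: power_le_one)
  \<comment> \<open>The aim is k s \<le> (1 - t) k + t, whose right side is the overlap of \<gamma>
    t with \<eta>; after division by s the normalized point has overlap at least k. The squared
    inequality rests on k \<le> 1.\<close>
  have "k\<^sup>2 * N t = (1 - t)\<^sup>2 * k\<^sup>2 + k\<^sup>2 * t\<^sup>2 + 2 * (t * (1 - t) * k) * k\<^sup>2"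
    by (simp add: N_def algebra_simps)
  also have "\<dots> \<le> (1 - t)\<^sup>2 * k\<^sup>2 + 1 * t\<^sup>2 + 2 * (t * (1 - t) * k) * 1"
    using t k k2 by (intro add_mono mult_right_mono mult_left_mono order_refl) simp_all
  also have "\<dots> = ((1 - t) * k + t)\<^sup>2" by (simp add: power2_eq_square algebra_simps)
  finally have "(k * s)\<^sup>2 \<le> ((1 - t) * k + t)\<^sup>2" by (simp add: power_mult_distrib s)
  moreover have "0 \<le> (1 - t) * k + t" using t k by simp
  ultimately have ks: "k * s \<le> (1 - t) * k + t" by (rule power2_le_imp_le)
  have "cmod (braket \<eta> \<theta>) = inverse s * ((1 - t) * k + t)"
  proof -
    have "braket \<eta> \<theta> = of_real (inverse s * ((1 - t) * k + t))"
      unfolding \<theta>_def \<gamma>_def braket_smult_right braket_add_right \<eta> braket_self by simp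
    moreover have "0 \<le> inverse s * ((1 - t) * k + t)" using s(1) t k by simp
    ultimately show ?thesis by (simp only: norm_of_real abs_of_nonneg)
  qed
  moreover have "cmod (braket \<eta> \<theta>) = cmod (braket \<xi> \<theta>)"
    by (simp add: \<eta>_def braket_smult_left norm_mult \<omega>)
  ultimately have "s * cmod (braket \<xi> \<theta>) = (1 - t) * k + t" using s(1) by simp
  then have "s * k \<le> s * cmod (braket \<xi> \<theta>)" using ks by (simp add: mult.commute)
  then have "k \<le> cmod (braket \<xi> \<theta>)" using s(1) by simp
  then show thesis using that[OF 1 2] by (simp add: k_def z_def)
qed

text \<open>If \<phi> has at most the concurrence of \<xi>, it lies in \<open>G\<close> and is its
  own witness, which is where f \<le> 1 enters. Otherwise its concurrence lies between those of
  \<xi> and \<psi>; the geodesic provides a state of that concurrence with enough overlap with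
  \<xi>, and a local unitary carries it to \<phi> and \<xi> to another member of
  \<open>G\<close>.\<close>

lemma down_closed_overlap:
  assumes G: "down_closed G" and f: "f \<le> 1"
  shows "down_closed {\<psi>. pure_state \<psi> \<and> (\<exists>\<xi>\<in>G. f \<le> cmod (braket \<xi> \<psi>))}"
  unfolding down_closed_def
proof (intro conjI ballI allI impI)
  fix \<psi> \<phi>
  assume "\<psi> \<in> {\<psi>. pure_state \<psi> \<and> (\<exists>\<xi>\<in>G. f \<le> cmod (braket \<xi> \<psi>))}"
    and "pure_state \<phi> \<and> concurrence \<phi> \<le> concurrence \<psi>"
  then obtain \<xi> where \<psi>: "pure_state \<psi>" and \<xi>: "\<xi> \<in> G" "f \<le> cmod (braket \<xi> \<psi>)"
    and \<phi>: "pure_state \<phi>" "concurrence \<phi> \<le> concurrence \<psi>" by blast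
  have p\<xi>: "pure_state \<xi>" using \<xi>(1) G by (simp add: down_closed_def)
  have "\<exists>\<xi>\<in>G. f \<le> cmod (braket \<xi> \<phi>)"
  proof (cases "concurrence \<phi> \<le> concurrence \<xi>")
    case True
    then have "\<phi> \<in> G" using G \<xi>(1) \<phi>(1) unfolding down_closed_def by blast
    moreover have "cmod (braket \<phi> \<phi>) = 1" using \<phi>(1) by (simp add: braket_self pure_state_def)
    ultimately show ?thesis using f by (intro bexI[of _ \<phi>]) simp_all
  next
    case False
    then obtain \<theta> where \<theta>: "pure_state \<theta>" "concurrence \<theta> = concurrence \<phi>"
        "cmod (braket \<xi> \<psi>) \<le> cmod (braket \<xi> \<theta>)"
      using geodesic_concurrence[OF \<psi> p\<xi>, of "concurrence \<phi>"] \<phi>(2) by auto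
    obtain U V :: qubit_op where U: "unitary U" and V: "unitary V" and \<phi>\<theta>: "\<phi> = tensor_op U V *v \<theta>"
      using local_unitary_equivalence[OF \<theta>(1) \<phi>(1) \<theta>(2)] .
    have "braket (tensor_op U V *v \<xi>) \<phi> = braket \<xi> \<theta>"
      unfolding \<phi>\<theta> using U V by (simp add: braket_unitary unitary_tensor_op)
    moreover have "tensor_op U V *v \<xi> \<in> G"
    proof -
      have "pure_state (tensor_op U V *v \<xi>)" "concurrence (tensor_op U V *v \<xi>) = concurrence \<xi>"
        using p\<xi> U V by (simp_all add: pure_state_def norm_unitary unitary_tensor_op concurrence_local_unitary)
      then show ?thesis using G \<xi>(1) unfolding down_closed_def by fastforce
    qed
    ultimately show ?thesis using \<xi>(2) \<theta>(3) by (metis order_trans)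
  qed
  then show "\<phi> \<in> {\<psi>. pure_state \<psi> \<and> (\<exists>\<xi>\<in>G. f \<le> cmod (braket \<xi> \<psi>))}" using \<phi>(1) by blast
qed blast

section \<open>Density matrices as mixtures of pure states\<close>

definition psd :: "complex ^ 'n ^ 'n \<Rightarrow> bool" where
  "psd R \<longleftrightarrow> dagger R = R \<and> (\<forall>v. 0 \<le> Re (braket v (R *v v)))"

lemma psd_sym: "psd R \<Longrightarrow> cnj (R $ i $ j) = R $ j $ i"
proof -
  assume "psd R"
  then have "dagger R $ j $ i = R $ j $ i" by (simp add: psd_def)
  then show ?thesis by (simp add: dagger_def)
qed

lemma braket_axis_left: "braket (axis i 1) x = x $ i"
  by (simp add: braket_def axis_def if_distrib[of cnj] if_distrib[of "\<lambda>x. x * _"] cong: if_cong)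

lemma psd_braket_commute: "psd R \<Longrightarrow> braket x (R *v y) = cnj (braket y (R *v x))"
  by (simp add: cnj_braket braket_dagger psd_def)

text \<open>The Hermitian form along a coordinate line, as a quadratic in \<open>c\<close>. Suitable
  choices of \<open>c\<close> yield both the vanishing of rows with zero diagonal entry and the
  positivity of the Schur complement.\<close>

lemma Re_braket_axis_comb:
  assumes "psd R"
  shows "Re (braket (v + c *s axis i 1) (R *v (v + c *s axis i 1)))
    = Re (braket v (R *v v)) + 2 * Re (cnj c * (R *v v) $ i) + (cmod c)\<^sup>2 * Re (R $ i $ i)"
proof -
  have 1: "braket v (R *v axis i 1) = cnj ((R *v v) $ i)"
    using psd_braket_commute[OF assms, of v "axis i 1"] by (simp add: braket_axis_left)
  have 2: "(R *v axis i 1) $ i = R $ i $ i"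
    by (simp add: matrix_vector_mult_def axis_def if_distrib[of "\<lambda>x. _ * x"] cong: if_cong)
  have "braket (v + c *s axis i 1) (R *v (v + c *s axis i 1))
    = braket v (R *v v) + (cnj c * (R *v v) $ i + cnj (cnj c * (R *v v) $ i)) + (cnj c * c) * R $ i $ i"
    by (simp add: matrix_vector_right_distrib vector_scalar_commute braket_add_left braket_add_right
        braket_smult_left braket_smult_right braket_axis_left 1 2 algebra_simps)
  then show ?thesis unfolding complex_add_cnj cnj_mult_self by (simp flip: of_real_power)
qed

lemma psd_diag_nonneg: "psd R \<Longrightarrow> 0 \<le> Re (R $ i $ i)"
proof -
  assume R: "psd R"
  then have "0 \<le> Re (braket (axis i 1) (R *v axis i 1))" by (simp add: psd_def)
  then show ?thesis using Re_braket_axis_comb[OF R, of 0 1 i] by (simp add: braket_def[of 0])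
qed

lemma psd_diag_real: "psd R \<Longrightarrow> R $ i $ i = of_real (Re (R $ i $ i))"
  using psd_sym[of R i i] by (simp add: complex_eq_iff)

text \<open>Along the j-th coordinate the form has no quadratic term, so a nonzero linear term would
  make it negative somewhere.\<close>

lemma psd_diag_zero:
  assumes R: "psd R" and 0: "R $ j $ j = 0"
  shows "R $ j $ i = 0"
proof (rule ccontr)
  assume nz: "R $ j $ i \<noteq> 0"
  define v :: "complex ^ 'a" where "v = axis i 1"
  have Rv: "(R *v v) $ k = R $ k $ i" for k
    by (simp add: v_def matrix_vector_mult_def axis_def if_distrib[of "\<lambda>x. _ * x"] cong: if_cong)
  define m where "m = (cmod (R $ j $ i))\<^sup>2"
  have m: "m > 0" using nz by (simp add: m_def)
  \<comment> \<open>Scaled so that the form takes the value -1.\<close>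
  define s where "s = (Re (R $ i $ i) + 1) / (2 * m)"
  define c where "c = - of_real s * R $ j $ i"
  have "cnj c * R $ j $ i = - of_real (s * m)"
    by (simp add: c_def cnj_mult_self mult.assoc m_def)
  moreover have "0 \<le> Re (braket (v + c *s axis j 1) (R *v (v + c *s axis j 1)))"
    using R by (simp add: psd_def)
  moreover have "braket v (R *v v) = R $ i $ i"
    using braket_axis_left[of i "R *v v"] Rv[of i] by (simp add: v_def)
  ultimately have "0 \<le> Re (R $ i $ i) - 2 * (s * m)"
    unfolding Re_braket_axis_comb[OF R] Rv 0 by simp
  moreover have "2 * (s * m) = Re (R $ i $ i) + 1" using m by (simp add: s_def)
  ultimately show False by linarith
qed

text \<open>One step of Cholesky elimination: \<open>w\<close> is the i-th column scaled so that
  \<open>ketbra w\<close> agrees with \<open>R\<close> in row and column i. Vanishing diagonal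
  entries stay zero, so the number of nonzero ones drops.\<close>

lemma psd_schur_complement:
  fixes R :: "complex ^ 'n ^ 'n"
  assumes R: "psd R" and nz: "R $ i $ i \<noteq> 0"
  defines "w \<equiv> \<chi> j. R $ j $ i / of_real (sqrt (Re (R $ i $ i)))"
  shows "psd (R - ketbra w)" "(R - ketbra w) $ i $ i = 0"
    "\<And>j. R $ j $ j = 0 \<Longrightarrow> (R - ketbra w) $ j $ j = 0"
proof -
  define r where "r = Re (R $ i $ i)"
  have Rii: "R $ i $ i = of_real r" unfolding r_def by (rule psd_diag_real[OF R])
  have "r \<ge> 0" unfolding r_def by (rule psd_diag_nonneg[OF R])
  moreover have "r \<noteq> 0" using nz unfolding Rii by simp
  ultimately have r: "r > 0" by simp
  have rr: "complex_of_real (sqrt r) * of_real (sqrt r) = of_real r"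
    using r by (simp flip: of_real_mult)
  have ww: "w $ j * cnj (w $ k) = R $ j $ i * R $ i $ k / of_real r" for j k
    by (simp add: w_def r_def[symmetric] rr psd_sym[OF R])
  have "dagger (R - ketbra w) = R - ketbra w"
    by (simp add: dagger_def ketbra_def vec_eq_iff psd_sym[OF R] mult.commute)
  moreover have "0 \<le> Re (braket v ((R - ketbra w) *v v))" for v
  proof -
    define b where "b = (R *v v) $ i"
    have "braket w v = b / of_real (sqrt r)"
      by (simp add: braket_def w_def b_def matrix_vector_mult_def psd_sym[OF R] r_def[symmetric] sum_divide_distrib)
    then have "cmod (braket v w) = cmod b / sqrt r"
      unfolding cnj_braket[of w v, symmetric] complex_mod_cnj
      using r by (simp only: norm_divide norm_of_real abs_of_pos real_sqrt_gt_zero)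
    then have bw: "(cmod (braket v w))\<^sup>2 = (cmod b)\<^sup>2 / r"
      using r by (simp add: power_divide)
    have cb: "cnj (- (b / of_real r)) * b = - of_real ((cmod b)\<^sup>2 / r)"
      by (simp add: cnj_mult_self)
    \<comment> \<open>This multiple of the axis vector minimizes the form of \<open>R\<close> on the
      line through \<open>v\<close>, and the minimum is the form of the Schur complement at
      \<open>v\<close>.\<close>
    have "0 \<le> Re (braket (v + (- (b / of_real r)) *s axis i 1) (R *v (v + (- (b / of_real r)) *s axis i 1)))"
      using R by (simp add: psd_def)
    also have "\<dots> = Re (braket v (R *v v)) - 2 * ((cmod b)\<^sup>2 / r) + ((cmod b)\<^sup>2 / r\<^sup>2) * r"
      unfolding Re_braket_axis_comb[OF R] b_def[symmetric] cb r_def[symmetric]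
      using r by (simp add: norm_divide power_divide)
    also have "\<dots> = Re (braket v (R *v v)) - (cmod b)\<^sup>2 / r"
      using r by (simp add: power2_eq_square field_simps)
    also have "\<dots> = Re (braket v ((1 *\<^sub>R R + (- 1) *\<^sub>R ketbra w) *v v))"
      unfolding Re_braket_comb braket_ketbra bw by simp
    finally show ?thesis by simp
  qed
  ultimately show "psd (R - ketbra w)" by (simp add: psd_def)
  show "(R - ketbra w) $ i $ i = 0" using r by (simp add: ketbra_def ww Rii)
  show "(R - ketbra w) $ j $ j = 0" if "R $ j $ j = 0" for j
    using psd_diag_zero[OF R that] that by (simp add: ketbra_def ww)
qed

lemma psd_sum_ketbra:
  fixes R :: "complex ^ 'n ^ 'n"
  assumes "psd R"
  shows "\<exists>(n::nat) w. R = (\<Sum>k<n. ketbra (w k))"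
  using assms
proof (induction "card {i. R $ i $ i \<noteq> 0}" arbitrary: R rule: less_induct)
  case less
  show ?case
  proof (cases "\<forall>i. R $ i $ i = 0")
    case True
    then have "R = 0" using psd_diag_zero[OF less.prems] by (simp add: vec_eq_iff)
    then show ?thesis by (intro exI[of _ 0]) simp
  next
    case False
    then obtain i where i: "R $ i $ i \<noteq> 0" by blast
    define w where "w = (\<chi> j. R $ j $ i / of_real (sqrt (Re (R $ i $ i))))"
    note S = psd_schur_complement[OF less.prems i, folded w_def]
    have "{j. (R - ketbra w) $ j $ j \<noteq> 0} \<subset> {j. R $ j $ j \<noteq> 0}"
      using i S(2,3) by blast
    then have "card {j. (R - ketbra w) $ j $ j \<noteq> 0} < card {j. R $ j $ j \<noteq> 0}"
      by (intro psubset_card_mono) auto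
    then obtain n :: nat and u where "R - ketbra w = (\<Sum>k<n. ketbra (u k))"
      using less.hyps S(1) by blast
    then have "R = (\<Sum>k<n. ketbra (u k)) + ketbra w" by (simp add: algebra_simps)
    also have "(\<Sum>k<n. ketbra (u k)) = (\<Sum>k<n. ketbra ((u(n := w)) k))"
      by (intro sum.cong) auto
    finally have "R = (\<Sum>k<Suc n. ketbra ((u(n := w)) k))" by simp
    then show ?thesis by blast
  qed
qed

lemma trace_ketbra: "trace (ketbra x) = of_real ((norm x)\<^sup>2)"
  by (simp add: trace_def ketbra_def norm_power2_vec mult_cnj_self)

lemma density_matrix_ketbra: "pure_state \<psi> \<Longrightarrow> density_matrix (ketbra \<psi>)"
  unfolding density_matrix_def
  by (simp add: braket_ketbra trace_ketbra pure_state_def)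
     (simp add: dagger_def ketbra_def vec_eq_iff mult.commute)

lemma convex_S_all: "convex S_all"
proof (rule convexI)
  fix X Y :: op2 and a b :: real
  assume "X \<in> S_all" "Y \<in> S_all" "0 \<le> a" "0 \<le> b" "a + b = 1"
  moreover have "dagger (a *\<^sub>R X + b *\<^sub>R Y) = a *\<^sub>R dagger X + b *\<^sub>R dagger Y"
    by (simp add: dagger_def vec_eq_iff)
  moreover have "trace (a *\<^sub>R X + b *\<^sub>R Y) = a *\<^sub>R trace X + b *\<^sub>R trace Y"
    by (simp add: trace_def sum.distrib scaleR_sum_right)
  moreover have "complex_of_real a + of_real b = 1" using \<open>a + b = 1\<close> by (simp flip: of_real_add)
  ultimately show "a *\<^sub>R X + b *\<^sub>R Y \<in> S_all"
    by (simp add: S_all_def density_matrix_def Re_braket_comb scaleR_conv_of_real[where 'a = complex])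
qed

text \<open>A decomposition into unnormalized ketbras of total squared norm 1 is an ensemble to
  which merging applies, here with the bound on the form discarded.\<close>

lemma S_all_eq_hull: "S_all = convex hull (ketbra ` {\<psi>. pure_state \<psi>})"
proof
  show "convex hull (ketbra ` {\<psi>. pure_state \<psi>}) \<subseteq> S_all"
    by (intro hull_minimal convex_S_all) (auto simp: S_all_def density_matrix_ketbra)
  show "S_all \<subseteq> convex hull (ketbra ` {\<psi>. pure_state \<psi>})"
  proof
    fix R assume "R \<in> S_all"
    then have R: "psd R" "trace R = 1" by (auto simp: S_all_def density_matrix_def psd_def)
    obtain n :: nat and w where w: "R = (\<Sum>k<n. ketbra (w k))" using psd_sum_ketbra[OF R(1)] by blast
    have "complex_of_real (\<Sum>k<n. (norm (w k))\<^sup>2) = trace R"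
      unfolding w trace_sum trace_ketbra by (rule of_real_sum)
    then have N: "(\<Sum>k<n. (norm (w k))\<^sup>2) = 1" unfolding R(2) by (simp only: of_real_eq_1_iff)
    have "R \<in> convex hull (ketbra ` cform.level 1 (\<Sum>k<n. cmod (cform (w k) (w k))))"
      using cform.sum_ketbra_in_hull_level[of w n] unfolding w N .
    moreover have "cform.level 1 T \<subseteq> {\<psi>. pure_state \<psi>}" for T
      by (auto simp: cform.level_def pure_state_def abs_square_eq_1)
    ultimately show "R \<in> convex hull (ketbra ` {\<psi>. pure_state \<psi>})"
      by (meson hull_mono image_mono subsetD)
  qed
qed

section \<open>The families as threshold sets\<close>

lemma majorizes_pair: "a + b = c + d \<Longrightarrow> majorizes [a, b] [c, d] \<longleftrightarrow> c \<le> a"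
  by (auto simp: majorizes_def numeral_2_eq_2 atLeastAtMostSuc_conv)

lemma scaled_weak_majorizes_pair:
  "scaled_weak_majorizes p [a, b] [c, d] \<longleftrightarrow> p * (a + b) \<le> c + d \<and> p * b \<le> d"
  by (auto simp: scaled_weak_majorizes_def numeral_2_eq_2 less_Suc_eq)

definition schmidt_min_le_set :: "real \<Rightarrow> ket2 set" where
  "schmidt_min_le_set m = {\<psi>. pure_state \<psi> \<and> schmidt_min \<psi> \<le> m}"

lemma down_closed_schmidt_min_le_set: "down_closed (schmidt_min_le_set m)"
  unfolding down_closed_def schmidt_min_le_set_def using schmidt_min_mono order_trans by blast

lemma S_exact_eq:
  assumes "a + b = 1"
  shows "S_exact [a, b] = convex hull (ketbra ` schmidt_min_le_set b)"
proof -
  have "majorizes (schmidt_coeffs \<psi>) [a, b] \<longleftrightarrow> schmidt_min \<psi> \<le> b" if "pure_state \<psi>" for \<psi>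
    using assms by (subst schmidt_coeffs_eq[OF that], subst majorizes_pair) auto
  then show ?thesis unfolding S_exact_def schmidt_min_le_set_def image_def
    by (intro arg_cong[where f = "(hull) convex"]) blast
qed

text \<open>The condition on the full sum reads p \<le> 1; the tail condition bounds p times the
  smaller coefficient by b, which moves the threshold to b/p.\<close>

lemma S_prob_eq:
  assumes "a + b = 1" "0 < p" "p \<le> 1"
  shows "S_prob [a, b] p = convex hull (ketbra ` schmidt_min_le_set (b / p))"
proof -
  have "scaled_weak_majorizes p (schmidt_coeffs \<psi>) [a, b] \<longleftrightarrow> schmidt_min \<psi> \<le> b / p" if "pure_state \<psi>" for \<psi>
    using assms by (simp add: schmidt_coeffs_eq[OF that] scaled_weak_majorizes_pair pos_le_divide_eq mult.commute)
  then show ?thesis unfolding S_prob_def schmidt_min_le_set_def image_def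
    by (intro arg_cong[where f = "(hull) convex"]) blast
qed

text \<open>The reference states are pure members of a hull; by extremality they are exactly the
  generators of the exact set.\<close>

lemma S_app_eq:
  assumes "a + b = 1"
  shows "S_app [a, b] f = convex hull
    (ketbra ` {\<psi>. pure_state \<psi> \<and> (\<exists>\<xi>\<in>schmidt_min_le_set b. f \<le> cmod (braket \<xi> \<psi>))})"
proof -
  have "pure_state \<xi> \<and> ketbra \<xi> \<in> S_exact [a, b] \<longleftrightarrow> \<xi> \<in> schmidt_min_le_set b" for \<xi>
    unfolding S_exact_eq[OF assms]
    using pure_in_hull_iff[OF down_closed_schmidt_min_le_set] by (auto simp: schmidt_min_le_set_def)
  then show ?thesis unfolding S_app_def image_def
    by (intro arg_cong[where f = "(hull) convex"]) blast
qed

theorem theorem4: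
  fixes \<mu>1 \<mu>2 :: real
  assumes "\<mu>1 \<ge> \<mu>2" and "\<mu>2 \<ge> 0" and "\<mu>1 + \<mu>2 = 1"
  shows "locc_plus (S_exact [\<mu>1, \<mu>2]) = S_exact [\<mu>1, \<mu>2] \<and>
    (\<forall>p. 0 < p \<and> p \<le> 1 \<longrightarrow> locc_plus (S_prob [\<mu>1, \<mu>2] p) = S_prob [\<mu>1, \<mu>2] p) \<and>
    (\<forall>f. 0 \<le> f \<and> f \<le> 1 \<longrightarrow> locc_plus (S_app [\<mu>1, \<mu>2] f) = S_app [\<mu>1, \<mu>2] f) \<and>
    (\<forall>q. 0 < q \<and> q \<le> 2 * \<mu>2 \<longrightarrow> S_prob [\<mu>1, \<mu>2] q = S_all) \<and>
    (\<forall>q. 2 * \<mu>2 < q \<and> q \<le> 1 \<longrightarrow>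
       S_prob [\<mu>1, \<mu>2] q = S_exact [1 - \<mu>2 / q, \<mu>2 / q])"
proof (intro conjI allI impI; (elim conjE)?)
  show "locc_plus (S_exact [\<mu>1, \<mu>2]) = S_exact [\<mu>1, \<mu>2]"
    unfolding S_exact_eq[OF assms(3)] by (rule locc_plus_hull[OF down_closed_schmidt_min_le_set])
next
  fix p :: real assume "0 < p" "p \<le> 1"
  then show "locc_plus (S_prob [\<mu>1, \<mu>2] p) = S_prob [\<mu>1, \<mu>2] p"
    unfolding S_prob_eq[OF assms(3) \<open>0 < p\<close> \<open>p \<le> 1\<close>]
    by (intro locc_plus_hull[OF down_closed_schmidt_min_le_set])
next
  fix f :: real assume "0 \<le> f" "f \<le> 1"
  then show "locc_plus (S_app [\<mu>1, \<mu>2] f) = S_app [\<mu>1, \<mu>2] f"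
    unfolding S_app_eq[OF assms(3)]
    by (intro locc_plus_hull down_closed_overlap down_closed_schmidt_min_le_set)
next
  fix q :: real assume q: "0 < q" "q \<le> 2 * \<mu>2"
  \<comment> \<open>Since \<mu>2 \<le> 1/2, also q \<le> 1. The threshold \<mu>2/q reaches 1/2,
    which no smaller Schmidt coefficient exceeds.\<close>
  then have "q \<le> 1" "1 / 2 \<le> \<mu>2 / q" using assms by (auto simp: field_simps)
  then have "schmidt_min_le_set (\<mu>2 / q) = {\<psi>. pure_state \<psi>}"
    unfolding schmidt_min_le_set_def using schmidt_min_bounds(2) order_trans by blast
  then show "S_prob [\<mu>1, \<mu>2] q = S_all"
    unfolding S_prob_eq[OF assms(3) q(1) \<open>q \<le> 1\<close>] S_all_eq_hull by simp
next
  fix q :: real assume q: "2 * \<mu>2 < q" "q \<le> 1"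
  then have "0 < q" using assms by linarith
  \<comment> \<open>Both sides are hulls for the same threshold \<mu>2/q.\<close>
  show "S_prob [\<mu>1, \<mu>2] q = S_exact [1 - \<mu>2 / q, \<mu>2 / q]"
    unfolding S_prob_eq[OF assms(3) \<open>0 < q\<close> q(2)] by (subst S_exact_eq) simp_all
qed

end
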